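(* Let $\gamma\ge 0$, let $P(\rho)=\ln\rho$ if $\gamma=0$ and $P(\rho)=\rho^\gamma/\gamma$ if $\gamma>0$, and let $a$ be positive and continuously differentiable. Consider the conservative system $$\partial_t \mathbf u+\partial_x f(\mathbf u)=0\quad\text{with}\quad \mathbf u=(\rho,z,w)^{T},\quad f(\mathbf u)=v\,\mathbf u,\quad z=\rho\omega,\quad w=\rho h,\quad \omega=v+a(h)P(\rho),$$ with initial data $\mathbf u(0,x)=\mathbf u_\ell$ for $x<0$ and $\mathbf u(0,x)=\mathbf u_r$ for $x>0$. Define the critical right-state velocity by $$v_{\mathrm{crit}}:=v_\ell+a(h_\ell)\big(P(\rho_\ell)-P(\rho_r)\big).$$ (i) The (entropy admissible weak) solution to the Riemann problem with $v_r>v_{\mathrm{crit}}$ reads as $$ \mathbf u(t,x)= \begin{cases} \mathbf u_\ell & \text{for } x<t \lambda_1(\mathbf u_\ell), \\ \mathbf u_{\mathrm{rf}}(t,x) & \text{for } x\in \big( t\lambda_1(\mathbf u_\ell),t\lambda_1(\bar{\mathbf u}) \big) \text{ and } x/t=\lambda_1\big(\mathbf u_{\mathrm{rf}}(t,x)\big), \\ \bar{\mathbf u} & \text{for } x\in \big( t\lambda_1(\bar{\mathbf u}),tv_r \big), \\ \mathbf u_r & \text{for } x>t v_r. \end{cases} $$ The self-similar solution $\mathbf u_{\mathrm{rf}}=(\rho_{\mathrm{rf}},z_{\mathrm{rf}},w_{\mathrm{rf}})^T$ in the rarefaction fan reads as $$ \rho_{\mathrm{rf}}(t,x)= \begin{cases}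 \exp\!\left(\dfrac{\omega_\ell-x/t}{a(h_\ell)}-1\right) &\text{if } \gamma=0,\\[2mm] \left[\dfrac{\gamma\left(\omega_\ell-x/t\right)}{(1+\gamma)a(h_\ell)}\right]^{1/\gamma} &\text{if } \gamma>0, \end{cases} \qquad z_{\mathrm{rf}}=\rho_{\mathrm{rf}}\,\omega_\ell,\qquad w_{\mathrm{rf}}=\rho_{\mathrm{rf}}\,h_\ell . $$ The intermediate state $\bar{\mathbf u}$ is given by $$ \bar{\rho}= \begin{cases} \rho_\ell\exp\!\left(\dfrac{v_\ell-v_r}{a(h_\ell)}\right) & \text{if } \gamma=0,\\[2mm] \left(\rho_\ell^\gamma+\dfrac{\gamma(v_\ell-v_r)}{a(h_\ell)}\right)^{1/\gamma} & \text{if } \gamma>0, \end{cases} \qquad \bar v=v_r,\qquad \bar h=h_\ell . $$ (ii) In the other case $v_r<v_{\mathrm{crit}}$, the solution contains a Lax shock connecting the left state $\mathbf u_\ell$ to the intermediate state $\bar{\mathbf u}$, whose propagation speed is $$ s = \frac{v_\ell - \alpha v_r}{1-\alpha} \quad\text{with}\quad \alpha = \begin{cases} \exp\!\left(\dfrac{v_\ell-v_r}{a(h_\ell)}\right) & \text{for } \gamma=0,\\[2mm] \left(1+\dfrac{\gamma(v_\ell-v_r)}{a(h_\ell)\rho_\ell^\gamma}\right)^{1/\gamma} & \text{for } \gamma>0. \end{cases} $$ (iii) In particular, the system is of Temple class: the Hugoniot loci coincide with the corresponding rarefaction curves. Both shock and rarefaction waves connect the left state to the same intermediate state $\bar{\mathbf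 u}$. This wave is followed by a contact discontinuity connecting the intermediate state to the right state.
   Context: Here $\rho>0$ is the density, $v$ the velocity and $h$ a driver-dependent quantity. The velocity as a function of the conserved variables is $v=v(\rho,z,w)=\frac{z}{\rho}-a\big(\frac{w}{\rho}\big)P(\rho)$, so the flux is $f(\mathbf u)=v(\rho,z,w)\,\mathbf u$. For $k\in\{\ell,r\}$, the constant state $\mathbf u_k$ corresponds to $(\rho_k,v_k,h_k)$, with $\omega_k=v_k+a(h_k)P(\rho_k)$, $z_k=\rho_k\omega_k$, $w_k=\rho_kh_k$; likewise $\bar{\mathbf u}$ corresponds to $(\bar\rho,\bar v,\bar h)$. The characteristic speeds are $\lambda_1=v-a(h)P'(\rho)\rho$ and the double eigenvalue $\lambda_2=\lambda_3=v$. A Lax shock of the first family between $\mathbf u_\ell$ and $\bar{\mathbf u}$ with speed $s$ satisfies the Rankine-Hugoniot condition $s(\mathbf u_\ell-\bar{\mathbf u})=f(\mathbf u_\ell)-f(\bar{\mathbf u})$ and $\lambda_1(\bar{\mathbf u})<s<\lambda_1(\mathbf u_\ell)$. A rarefaction curve is an integral curve of an eigenvector field of the Jacobian of $f$.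
   Formalization: The case split by v_crit is false as printed; it is replaced by v_r > v_l in (i) and v_r < v_l in (ii) (v_r = v_l, with an empty fan, is not stated), and for γ > 0 the quantity ρ_l^γ + γ(v_l − v_r)/a(h_l) is assumed positive so that the intermediate density is positive. *)

theory Defs
  imports "HOL-Analysis.Analysis"
begin

section \<open>Systems of conservation laws in one space dimension\<close>

text \<open>
  \<open>\<Omega>\<close> is the set of admissible states and \<open>f\<close> the flux. A characteristic family is
  represented by the function \<open>lam\<close> giving its characteristic speed at each state.
\<close>

definition rankine_hugoniot :: "('a::euclidean_space \<Rightarrow> 'a) \<Rightarrow> 'a \<Rightarrow> 'a \<Rightarrow> real \<Rightarrow> bool" where
  "rankine_hugoniot f ul ur s \<longleftrightarrow> s *\<^sub>R (ul - ur) = f ul - f ur"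

definition lax_shock ::
  "('a::euclidean_space \<Rightarrow> 'a) \<Rightarrow> ('a \<Rightarrow> real) \<Rightarrow> 'a \<Rightarrow> 'a \<Rightarrow> real \<Rightarrow> bool" where
  "lax_shock f lam ul ur s \<longleftrightarrow> rankine_hugoniot f ul ur s \<and> lam ur < s \<and> s < lam ul"

definition contact_discontinuity ::
  "('a::euclidean_space \<Rightarrow> 'a) \<Rightarrow> ('a \<Rightarrow> real) \<Rightarrow> 'a \<Rightarrow> 'a \<Rightarrow> real \<Rightarrow> bool" where
  "contact_discontinuity f lam ul ur s \<longleftrightarrow>
     rankine_hugoniot f ul ur s \<and> lam ul = s \<and> lam ur = s"

text \<open>
  The Hugoniot locus of one family through \<open>u0\<close>: the states reached from \<open>u0\<close> along a curve of
  solutions \<open>(u, s)\<close> of the Rankine-Hugoniot condition that emanates from \<open>u0\<close> with the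
  characteristic speed \<open>s = lam u0\<close> of that family. The curve must leave \<open>u0\<close> for good, because
  \<open>u = u0\<close> solves the condition for every \<open>s\<close>.
\<close>

definition hugoniot_locus ::
  "'a set \<Rightarrow> ('a::euclidean_space \<Rightarrow> 'a) \<Rightarrow> ('a \<Rightarrow> real) \<Rightarrow> 'a \<Rightarrow> 'a set" where
  "hugoniot_locus \<Omega> f lam u0 = {u0} \<union>
     {u. \<exists>(c :: real \<Rightarrow> 'a) (s :: real \<Rightarrow> real).
           continuous_on {0..1} c \<and> continuous_on {0..1} s \<and>
           c 0 = u0 \<and> c 1 = u \<and> s 0 = lam u0 \<and>
           (\<forall>\<tau>\<in>{0<..1}. c \<tau> \<in> \<Omega> \<and> c \<tau> \<noteq> u0 \<and> rankine_hugoniot f u0 (c \<tau>) (s \<tau>))}"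

definition eigenvector_field ::
  "'a set \<Rightarrow> ('a::euclidean_space \<Rightarrow> 'a) \<Rightarrow> ('a \<Rightarrow> real) \<Rightarrow> ('a \<Rightarrow> 'a) \<Rightarrow> bool" where
  "eigenvector_field \<Omega> f lam r \<longleftrightarrow>
     continuous_on \<Omega> r \<and>
     (\<forall>u\<in>\<Omega>. f differentiable (at u) \<and> r u \<noteq> 0 \<and>
            frechet_derivative f (at u) (r u) = lam u *\<^sub>R r u)"

text \<open>
  All states on integral curves through \<open>u0\<close> of eigenvector fields of the family. Both
  directions are covered, since with \<open>r\<close> also \<open>- r\<close> is an eigenvector field. For a multiple
  eigenvalue the eigenvector fields are not unique up to scaling, and the set is then the
  union of the integral curves of all of them.
\<close>

definition rarefaction_curve ::
  "'a set \<Rightarrow> ('a::euclidean_space \<Rightarrow> 'a) \<Rightarrow> ('a \<Rightarrow> real) \<Rightarrow> 'a \<Rightarrow> 'a set" where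
  "rarefaction_curve \<Omega> f lam u0 =
     {u. \<exists>r (T::real) (c :: real \<Rightarrow> 'a).
           eigenvector_field \<Omega> f lam r \<and> 0 \<le> T \<and> c 0 = u0 \<and> c T = u \<and>
           (\<forall>\<tau>\<in>{0..T}. c \<tau> \<in> \<Omega> \<and>
              (c has_vector_derivative r (c \<tau>)) (at \<tau> within {0..T}))}"

definition temple_class ::
  "'a set \<Rightarrow> ('a::euclidean_space \<Rightarrow> 'a) \<Rightarrow> ('a \<Rightarrow> real) set \<Rightarrow> bool" where
  "temple_class \<Omega> f speeds \<longleftrightarrow>
     (\<forall>lam\<in>speeds. \<forall>u0\<in>\<Omega>. hugoniot_locus \<Omega> f lam u0 = rarefaction_curve \<Omega> f lam u0)"

text \<open>
  Test functions on \<open>[0,\<infinity>) \<times> \<real>\<close> are restrictions of compactly supported \<open>C\<^sup>1\<close> functions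
  \<open>\<phi>(t,x)\<close> on the plane; \<open>\<phi>t\<close> and \<open>\<phi>x\<close> are the partial derivatives.
\<close>

definition test_function ::
  "(real \<times> real \<Rightarrow> real) \<Rightarrow> (real \<times> real \<Rightarrow> real) \<Rightarrow> (real \<times> real \<Rightarrow> real) \<Rightarrow> bool" where
  "test_function \<phi> \<phi>t \<phi>x \<longleftrightarrow>
     (\<forall>p. (\<phi> has_derivative (\<lambda>d. \<phi>t p * fst d + \<phi>x p * snd d)) (at p)) \<and>
     continuous_on UNIV \<phi>t \<and> continuous_on UNIV \<phi>x \<and>
     (\<exists>K. compact K \<and> (\<forall>p. p \<notin> K \<longrightarrow> \<phi> p = 0))"

text \<open>
  The weak form of \<open>\<partial>\<^sub>t A(u) + \<partial>\<^sub>x B(u) = 0\<close> with initial data \<open>u0\<close>, tested with \<open>\<phi>\<close>.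
\<close>

definition weak_form ::
  "('a \<Rightarrow> 'b::euclidean_space) \<Rightarrow> ('a \<Rightarrow> 'b) \<Rightarrow> (real \<Rightarrow> 'a) \<Rightarrow> (real \<Rightarrow> real \<Rightarrow> 'a) \<Rightarrow>
   (real \<times> real \<Rightarrow> real) \<Rightarrow> (real \<times> real \<Rightarrow> real) \<Rightarrow> (real \<times> real \<Rightarrow> real) \<Rightarrow> 'b" where
  "weak_form A B u0 u \<phi> \<phi>t \<phi>x =
     (LINT p:{p. 0 < fst p}|lborel.
        \<phi>t p *\<^sub>R A (u (fst p) (snd p)) + \<phi>x p *\<^sub>R B (u (fst p) (snd p)))
     + (LINT x|lborel. \<phi> (0, x) *\<^sub>R A (u0 x))"

text \<open>
  Weak solutions are taken in \<open>L\<^sup>\<infinity>\<close> with values in a compact set of admissible states, so all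
  integrands are integrable for fluxes and entropies that are continuous on \<open>\<Omega>\<close>.
\<close>

definition weak_solution ::
  "'a set \<Rightarrow> ('a::euclidean_space \<Rightarrow> 'a) \<Rightarrow> (real \<Rightarrow> 'a) \<Rightarrow> (real \<Rightarrow> real \<Rightarrow> 'a) \<Rightarrow> bool" where
  "weak_solution \<Omega> f u0 u \<longleftrightarrow>
     u0 \<in> borel_measurable lborel \<and>
     set_borel_measurable lborel {p. 0 < fst p} (\<lambda>p. u (fst p) (snd p)) \<and>
     (\<exists>K. compact K \<and> K \<subseteq> \<Omega> \<and> (\<forall>x. u0 x \<in> K) \<and> (\<forall>t>0. \<forall>x. u t x \<in> K)) \<and>
     (\<forall>\<phi> \<phi>t \<phi>x. test_function \<phi> \<phi>t \<phi>x \<longrightarrow> weak_form (\<lambda>v. v) f u0 u \<phi> \<phi>t \<phi>x = 0)"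

definition convex_entropy_pair ::
  "'a set \<Rightarrow> ('a::euclidean_space \<Rightarrow> 'a) \<Rightarrow> ('a \<Rightarrow> real) \<Rightarrow> ('a \<Rightarrow> real) \<Rightarrow> bool" where
  "convex_entropy_pair \<Omega> f \<eta> q \<longleftrightarrow>
     convex_on \<Omega> \<eta> \<and>
     (\<exists>g. continuous_on \<Omega> g \<and>
        (\<forall>u\<in>\<Omega>. (\<eta> has_derivative (\<lambda>k. g u \<bullet> k)) (at u) \<and>
               (q has_derivative (\<lambda>k. g u \<bullet> frechet_derivative f (at u) k)) (at u)))"

definition entropy_weak_solution ::
  "'a set \<Rightarrow> ('a::euclidean_space \<Rightarrow> 'a) \<Rightarrow> (real \<Rightarrow> 'a) \<Rightarrow> (real \<Rightarrow> real \<Rightarrow> 'a) \<Rightarrow> bool" where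
  "entropy_weak_solution \<Omega> f u0 u \<longleftrightarrow>
     weak_solution \<Omega> f u0 u \<and>
     (\<forall>\<eta> q. convex_entropy_pair \<Omega> f \<eta> q \<longrightarrow>
        (\<forall>\<phi> \<phi>t \<phi>x. test_function \<phi> \<phi>t \<phi>x \<longrightarrow> (\<forall>p. 0 \<le> \<phi> p) \<longrightarrow>
           0 \<le> weak_form \<eta> q u0 u \<phi> \<phi>t \<phi>x))"

text \<open>The value at \<open>x = 0\<close> is immaterial.\<close>

definition riemann_data :: "'a \<Rightarrow> 'a \<Rightarrow> real \<Rightarrow> 'a" where
  "riemann_data ul ur x = (if x < 0 then ul else ur)"


section \<open>The traffic flow system with driver-dependent pressure\<close>

text \<open>States are the conserved variables \<open>(\<rho>, z, w)\<close>, \<open>z = \<rho> \<omega>\<close>, \<open>w = \<rho> h\<close>.\<close>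

type_synonym state = "real \<times> real \<times> real"

definition phase_space :: "state set" where
  "phase_space = {(\<rho>, z, w). 0 < \<rho>}"

definition pressure :: "real \<Rightarrow> real \<Rightarrow> real" where
  "pressure \<gamma> \<rho> = (if \<gamma> = 0 then ln \<rho> else \<rho> powr \<gamma> / \<gamma>)"

definition state_of :: "real \<Rightarrow> (real \<Rightarrow> real) \<Rightarrow> real \<Rightarrow> real \<Rightarrow> real \<Rightarrow> state" where
  "state_of \<gamma> a \<rho> v h = (\<rho>, \<rho> * (v + a h * pressure \<gamma> \<rho>), \<rho> * h)"

definition velocity :: "real \<Rightarrow> (real \<Rightarrow> real) \<Rightarrow> state \<Rightarrow> real" where
  "velocity \<gamma> a = (\<lambda>(\<rho>, z, w). z / \<rho> - a (w / \<rho>) * pressure \<gamma> \<rho>)"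

definition flux :: "real \<Rightarrow> (real \<Rightarrow> real) \<Rightarrow> state \<Rightarrow> state" where
  "flux \<gamma> a u = velocity \<gamma> a u *\<^sub>R u"

definition lambda1 :: "real \<Rightarrow> (real \<Rightarrow> real) \<Rightarrow> state \<Rightarrow> real" where
  "lambda1 \<gamma> a = (\<lambda>(\<rho>, z, w).
     velocity \<gamma> a (\<rho>, z, w) - a (w / \<rho>) * deriv (pressure \<gamma>) \<rho> * \<rho>)"

text \<open>The double eigenvalue \<open>\<lambda>\<^sub>2 = \<lambda>\<^sub>3\<close>.\<close>

definition lambda2 :: "real \<Rightarrow> (real \<Rightarrow> real) \<Rightarrow> state \<Rightarrow> real" where
  "lambda2 \<gamma> a = velocity \<gamma> a"

definition rho_bar :: "real \<Rightarrow> (real \<Rightarrow> real) \<Rightarrow> real \<Rightarrow> real \<Rightarrow> real \<Rightarrow> real \<Rightarrow> real" where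
  "rho_bar \<gamma> a \<rho>l vl hl vr =
     (if \<gamma> = 0 then \<rho>l * exp ((vl - vr) / a hl)
      else (\<rho>l powr \<gamma> + \<gamma> * (vl - vr) / a hl) powr (1 / \<gamma>))"

definition rho_rf :: "real \<Rightarrow> (real \<Rightarrow> real) \<Rightarrow> real \<Rightarrow> real \<Rightarrow> real \<Rightarrow> real \<Rightarrow> real" where
  "rho_rf \<gamma> a \<omega>l hl t x =
     (if \<gamma> = 0 then exp ((\<omega>l - x / t) / a hl - 1)
      else (\<gamma> * (\<omega>l - x / t) / ((1 + \<gamma>) * a hl)) powr (1 / \<gamma>))"

definition u_rf :: "real \<Rightarrow> (real \<Rightarrow> real) \<Rightarrow> real \<Rightarrow> real \<Rightarrow> real \<Rightarrow> real \<Rightarrow> state" where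
  "u_rf \<gamma> a \<omega>l hl t x =
     (let \<rho> = rho_rf \<gamma> a \<omega>l hl t x in (\<rho>, \<rho> * \<omega>l, \<rho> * hl))"

definition shock_alpha :: "real \<Rightarrow> (real \<Rightarrow> real) \<Rightarrow> real \<Rightarrow> real \<Rightarrow> real \<Rightarrow> real \<Rightarrow> real" where
  "shock_alpha \<gamma> a \<rho>l vl hl vr =
     (if \<gamma> = 0 then exp ((vl - vr) / a hl)
      else (1 + \<gamma> * (vl - vr) / (a hl * \<rho>l powr \<gamma>)) powr (1 / \<gamma>))"


section \<open>The critical velocity\<close>

definition v_crit :: "real \<Rightarrow> (real \<Rightarrow> real) \<Rightarrow> real \<Rightarrow> real \<Rightarrow> real \<Rightarrow> real \<Rightarrow> real" where
  "v_crit \<gamma> a \<rho>l vl hl \<rho>r = vl + a hl * (pressure \<gamma> \<rho>l - pressure \<gamma> \<rho>r)"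

text \<open>
  The first wave is a rarefaction wave for \<open>vl < vr\<close> and a shock for \<open>vr < vl\<close>. The comparison
  of \<open>vr\<close> with \<open>v_crit\<close> decides this if \<open>v_crit < vr\<close> and \<open>\<rho>r \<le> \<rho>l\<close>, or if
  \<open>vr < v_crit\<close> and \<open>\<rho>l \<le> \<rho>r\<close>, but not in general: the last two lemmas give data on
  the wrong side of \<open>v_crit\<close> in both directions.
\<close>

lemma pressure_mono:
  assumes "0 \<le> \<gamma>" "0 < x" "x \<le> y"
  shows "pressure \<gamma> x \<le> pressure \<gamma> y"
  using assms by (auto simp: pressure_def intro!: divide_right_mono powr_mono2)

lemma v_crit_imp_rarefaction:
  assumes "0 \<le> \<gamma>" "0 < a hl" "0 < \<rho>r" "\<rho>r \<le> \<rho>l" "v_crit \<gamma> a \<rho>l vl hl \<rho>r < vr"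
  shows "vl < vr"
proof -
  have "0 \<le> a hl * (pressure \<gamma> \<rho>l - pressure \<gamma> \<rho>r)"
    using assms pressure_mono[of \<gamma> \<rho>r \<rho>l] by simp
  then show ?thesis using assms(5) by (simp add: v_crit_def)
qed

lemma v_crit_imp_shock:
  assumes "0 \<le> \<gamma>" "0 < a hl" "0 < \<rho>l" "\<rho>l \<le> \<rho>r" "vr < v_crit \<gamma> a \<rho>l vl hl \<rho>r"
  shows "vr < vl"
proof -
  have "a hl * (pressure \<gamma> \<rho>l - pressure \<gamma> \<rho>r) \<le> 0"
    using assms pressure_mono[of \<gamma> \<rho>l \<rho>r] by (simp add: mult_nonneg_nonpos)
  then show ?thesis using assms(5) by (simp add: v_crit_def)
qed

lemma lambda1_state_of_1:
  assumes "0 < \<rho>"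
  shows "lambda1 1 (\<lambda>_. 1) (state_of 1 (\<lambda>_. 1) \<rho> v h) = v - \<rho>"
proof -
  have "(pressure 1 has_field_derivative 1) (at \<rho>)"
    unfolding pressure_def
    by (rule DERIV_cong[OF has_field_derivative_transform_within_open
          [of "\<lambda>x. x" 1 \<rho> "{0<..}"]])
      (use assms in auto)
  then have "deriv (pressure 1) \<rho> = 1" by (rule DERIV_imp_deriv)
  with assms show ?thesis by (simp add: lambda1_def velocity_def state_of_def)
qed

lemma v_crit_less_no_rarefaction:
  fixes a :: "real \<Rightarrow> real"
  defines "a \<equiv> \<lambda>_. 1"
  shows "v_crit 1 a 1 1 0 3 < 1/2"
    and "lambda1 1 a (state_of 1 a (rho_bar 1 a 1 1 0 (1/2)) (1/2) 0)
           < lambda1 1 a (state_of 1 a 1 1 0)"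
  by (simp_all add: a_def v_crit_def pressure_def rho_bar_def lambda1_state_of_1)

lemma less_v_crit_no_shock:
  fixes a :: "real \<Rightarrow> real"
  defines "a \<equiv> \<lambda>_. 1"
  shows "1 < v_crit 1 a 2 0 0 (1/2)"
    and "\<not> lax_shock (flux 1 a) (lambda1 1 a) (state_of 1 a 2 0 0)
             (state_of 1 a (rho_bar 1 a 2 0 0 1) 1 0) s"
  by (simp_all add: a_def v_crit_def pressure_def rho_bar_def lambda1_state_of_1 lax_shock_def)

end

theory Submission
  imports Defs
begin

text \<open>
  For a test function \<open>\<phi>\<close>, the integrals of \<open>\<phi>\<^sub>t\<close> and \<open>\<phi>\<^sub>x\<close> over a wedge \<open>{t > 0, x \<ge> \<sigma> t}\<close> reduce, by
  the shear \<open>x \<mapsto> x + \<sigma> t\<close>, to integrals over the line \<open>t = 0\<close> and the ray \<open>x = \<sigma> t\<close>. A self-similar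
  function is a superposition of indicators of wedges, finitely many for shocks and contacts and a
  continuum (layer cake in the density) for the rarefaction fan. Its weak form is therefore a
  superposition of the Rankine-Hugoniot defects of the single jumps, and the defects of the
  infinitesimal jumps in the fan vanish.

  On the rays \<open>\<rho> (1, \<omega>, h)\<close> in state space the system is the scalar law with the concave flux
  \<open>\<rho> (\<omega> - a(h) P(\<rho>))\<close>. These rays are at once the integral curves and the Hugoniot curves of the first
  family, and the entropy inequality for the shock is the scalar one. The second family is linearly
  degenerate. Both of its curves through a state fill the level set of the velocity, a half plane in the
  coordinates \<open>(\<rho>, h)\<close>.
\<close>

section \<open>Weak form of self-similar functions\<close>

text \<open>The quantities \<omega> and h are homogeneous of degree 0 in the conserved vector, so
  moving along \<open>u\<close> itself changes only the density, and \<open>u\<close> is an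
  eigenvector of the Jacobian for the first speed. That is why the first family consists of straight
  rays, why an entropy pair satisfies q' = \<lambda>1 \<eta>' along them, and hence why a layer of
  density r that moves with speed \<lambda>1(r) leaves no defect. The fan is layered by density and
  not by x/t: the speed is then an explicit function of the layer, and no derivative of the solution
  is ever taken. The weak form is computed once for a general entropy pair, as an exact multiple of
  one ray integral; conservation and the entropy inequality are both read off from it. The delicate
  point for the Hugoniot loci is the base state, where the jump condition holds with every speed.
  The initial speed of a curve is accessible only as a limit, so the secant slope along a ray must
  be extended continuously to that state.\<close>

lemma integrable_compact_support_scaleR:
  fixes f :: "'a::euclidean_space \<Rightarrow> real" and b :: "'a \<Rightarrow> 'b::euclidean_space"
  assumes "continuous_on UNIV f" "compact K" "\<And>p. p \<notin> K \<Longrightarrow> f p = 0"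
    and "b \<in> borel_measurable lborel" "\<And>p. norm (b p) \<le> B"
  shows "integrable lborel (\<lambda>p. f p *\<^sub>R b p)"
proof -
  have eq: "(\<lambda>p. indicator K p *\<^sub>R f p) = f"
    using assms(3) by (auto simp: indicator_def fun_eq_iff)
  have "integrable lborel (\<lambda>p. indicator K p *\<^sub>R f p)"
    using assms by (intro borel_integrable_compact) (auto intro: continuous_on_subset)
  then have int: "integrable lborel f" by (simp only: eq)
  show ?thesis
  proof (rule Bochner_Integration.integrable_bound[of _ "\<lambda>p. B * f p"])
    show "integrable lborel (\<lambda>p. B * f p)" using int by simp
    show "(\<lambda>p. f p *\<^sub>R b p) \<in> borel_measurable lborel"
      using borel_measurable_integrable[OF int] assms(4) by measurable
    have "\<bar>f p\<bar> * norm (b p) \<le> \<bar>B\<bar> * \<bar>f p\<bar>" for p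
      using mult_right_mono[OF order_trans[OF assms(5)[of p] abs_ge_self], of "\<bar>f p\<bar>"]
      by (simp add: mult.commute)
    then show "AE p in lborel. norm (f p *\<^sub>R b p) \<le> norm (B * f p)"
      by (auto simp: abs_mult)
  qed
qed

lemma
  fixes F f :: "real \<Rightarrow> real"
  assumes F: "\<And>x. (F has_field_derivative f x) (at x)" and f: "continuous_on UNIV f"
    and K: "compact K" "\<And>x. x \<notin> K \<Longrightarrow> F x = 0"
  shows integral_deriv_halfline: "(LINT x|lborel. f x * indicator {c..} x) = - F c"
    and integral_deriv_line: "(LINT x|lborel. f x) = 0"
proof -
  obtain R where R: "\<And>x. x \<in> K \<Longrightarrow> \<bar>x\<bar> \<le> R"
    using compact_imp_bounded[OF K(1)] unfolding bounded_iff by auto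
  have f0: "f x = 0" if "\<bar>x\<bar> > R" for x
  proof -
    have "((\<lambda>_. 0) has_field_derivative f x) (at x)"
    proof (rule has_field_derivative_transform_within_open[OF F])
      show "open (- K)" using compact_imp_closed[OF K(1)] by (rule open_Compl)
      show "x \<in> - K" using that R by force
    qed (use K(2) in auto)
    then show ?thesis using DERIV_const DERIV_unique by blast
  qed
  have ftc: "(LINT x|lborel. f x * indicator {a..b} x) = F b - F a" if "a \<le> b" for a b
    using that F f by (intro integral_FTC_Icc_real) (auto simp: continuous_on_eq_continuous_at)
  have F0: "F x = 0" if "\<bar>x\<bar> > R" for x using that R K(2) by fastforce
  \<comment> \<open>The summand 1 puts b strictly beyond the support, so \<open>F b = 0\<close> and
    only the boundary term at c survives.\<close>
  define b where "b = max c R + \<bar>R\<bar> + 1"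
  have "f x * indicator {c..} x = f x * indicator {c..b} x" for x
    using f0[of x] by (cases "x \<le> b") (auto simp: indicator_def b_def)
  then have "(LINT x|lborel. f x * indicator {c..} x) = (LINT x|lborel. f x * indicator {c..b} x)"
    by presburger
  then show "(LINT x|lborel. f x * indicator {c..} x) = - F c"
    using ftc[of c b] F0[of b] by (simp add: b_def)
  have "f x = f x * indicator {-\<bar>R\<bar>-1..\<bar>R\<bar>+1} x" for x
    using f0[of x] by (cases "R < \<bar>x\<bar>") (auto simp: indicator_def)
  then have "(LINT x|lborel. f x) = (LINT x|lborel. f x * indicator {-\<bar>R\<bar>-1..\<bar>R\<bar>+1} x)"
    by presburger
  then show "(LINT x|lborel. f x) = 0"
    using ftc[of "-\<bar>R\<bar>-1" "\<bar>R\<bar>+1"] F0[of "-\<bar>R\<bar>-1"] F0[of "\<bar>R\<bar>+1"] by auto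
qed

text \<open>Bridges the open half line t > 0 of \<open>weak_form\<close> and the closed one used
  with the fundamental theorem; they differ in a null set.\<close>

lemma AE_pos_iff_nonneg: "AE t in lborel. (0 < t) = (0 \<le> (t::real))"
  using AE_lborel_singleton[of "0::real"] by eventually_elim auto

lemma lborel_Fubini:
  fixes h :: "'a::euclidean_space \<times> 'b::euclidean_space \<Rightarrow> real"
  assumes "integrable lborel h"
  shows "(LINT p|lborel. h p) = (LINT t|lborel. LINT x|lborel. h (t, x))"
    and "(LINT p|lborel. h p) = (LINT x|lborel. LINT t|lborel. h (t, x))"
proof -
  have i: "integrable (lborel \<Otimes>\<^sub>M lborel) (case_prod (\<lambda>t x. h (t, x)))"
    using assms by (simp add: lborel_prod)
  show "(LINT p|lborel. h p) = (LINT t|lborel. LINT x|lborel. h (t, x))"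
    using lborel_pair.integral_fst[OF i] by (simp add: lborel_prod)
  show "(LINT p|lborel. h p) = (LINT x|lborel. LINT t|lborel. h (t, x))"
    using lborel_pair.integral_snd[OF i] by (simp add: lborel_prod)
qed

text \<open>For fixed t the shear is a translation in x, so translation invariance on each slice
  suffices. Fubini is applied on both sides, hence the two integrability hypotheses.\<close>

lemma integral_lborel_shear:
  fixes h :: "real \<times> real \<Rightarrow> real"
  assumes "integrable lborel h" "integrable lborel (\<lambda>p. h (fst p, snd p + fst p * \<sigma>))"
  shows "(LINT p|lborel. h p) = (LINT p|lborel. h (fst p, snd p + fst p * \<sigma>))"
proof -
  have "(LINT x|lborel. h (t, x)) = (LINT x|lborel. h (t, x + t * \<sigma>))" for t
    using lborel_integral_real_affine[of 1 "\<lambda>x. h (t, x)" "t * \<sigma>"] by (simp add: add.commute)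
  then show ?thesis
    by (simp add: lborel_Fubini(1)[OF assms(1)] lborel_Fubini(1)[OF assms(2)])
qed

section \<open>Test functions, their slices, and integrals of their derivatives\<close>

context
  fixes \<phi> \<phi>t \<phi>x :: "real \<times> real \<Rightarrow> real"
  assumes test: "test_function \<phi> \<phi>t \<phi>x"
begin

lemma test_has_derivative: "(\<phi> has_derivative (\<lambda>d. \<phi>t p * fst d + \<phi>x p * snd d)) (at p)"
  using test unfolding test_function_def by blast

lemma test_continuous:
  "continuous_on UNIV \<phi>" "continuous_on UNIV \<phi>t" "continuous_on UNIV \<phi>x"
proof -
  show "continuous_on UNIV \<phi>"
    using has_derivative_continuous[OF test_has_derivative]
    by (intro continuous_at_imp_continuous_on) blast
qed (use test in \<open>simp_all add: test_function_def\<close>)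

text \<open>\<open>test_function\<close> asks for compact support of \<phi> alone. Off K the
  function is locally zero, so uniqueness of the derivative transfers the same K to both partial
  derivatives.\<close>

lemma test_compact_support:
  obtains K where "compact K"
    "\<And>p. p \<notin> K \<Longrightarrow> \<phi> p = 0" "\<And>p. p \<notin> K \<Longrightarrow> \<phi>t p = 0" "\<And>p. p \<notin> K \<Longrightarrow> \<phi>x p = 0"
proof -
  obtain K where K: "compact K" "\<And>p. p \<notin> K \<Longrightarrow> \<phi> p = 0"
    using test by (auto simp: test_function_def)
  have "\<phi>t p = 0 \<and> \<phi>x p = 0" if "p \<notin> K" for p
  proof -
    have "((\<lambda>_. 0) has_derivative (\<lambda>d. \<phi>t p * fst d + \<phi>x p * snd d)) (at p)"
    proof (rule has_derivative_transform_within_open[OF test_has_derivative])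
      show "open (- K)" using compact_imp_closed[OF K(1)] by (rule open_Compl)
    qed (use K(2) that in auto)
    then have "(\<lambda>d. \<phi>t p * fst d + \<phi>x p * snd d) = (\<lambda>_. 0)"
      using has_derivative_const has_derivative_unique by blast
    from fun_cong[OF this, of "(1, 0)"] fun_cong[OF this, of "(0, 1)"] show ?thesis by simp
  qed
  with K that show thesis by blast
qed

lemma test_integrable_scaleR:
  fixes b :: "real \<times> real \<Rightarrow> 'b::euclidean_space"
  assumes "b \<in> borel_measurable lborel" "\<And>p. norm (b p) \<le> B"
  shows "integrable lborel (\<lambda>p. \<phi>t p *\<^sub>R b p)" "integrable lborel (\<lambda>p. \<phi>x p *\<^sub>R b p)"
  using test_compact_support assms
  by (metis integrable_compact_support_scaleR test_continuous)+

lemma test_integrable: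
  assumes "b \<in> borel_measurable lborel" "\<And>p. \<bar>b p\<bar> \<le> B"
  shows "integrable lborel (\<lambda>p. \<phi>t p * b p)" "integrable lborel (\<lambda>p. \<phi>x p * b p)"
  using test_integrable_scaleR[of b B] assms by simp_all

lemma test_deriv_t: "((\<lambda>t. \<phi> (t, x)) has_field_derivative \<phi>t (t, x)) (at t)"
proof -
  have "((\<lambda>t. (t, x)) has_derivative (\<lambda>d. (d, 0))) (at t)"
    by (auto intro!: derivative_eq_intros)
  from has_derivative_compose[OF this test_has_derivative] show ?thesis
    by (simp add: has_field_derivative_def mult_commute_abs)
qed

lemma test_deriv_x: "((\<lambda>x. \<phi> (t, x)) has_field_derivative \<phi>x (t, x)) (at x)"
proof -
  have "((\<lambda>x. (t, x)) has_derivative (\<lambda>d. (0, d))) (at x)"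
    by (auto intro!: derivative_eq_intros)
  from has_derivative_compose[OF this test_has_derivative] show ?thesis
    by (simp add: has_field_derivative_def mult_commute_abs)
qed

lemma test_slice_t:
  shows "continuous_on UNIV (\<lambda>t. \<phi>t (t, x))" "\<exists>K. compact K \<and> (\<forall>t. t \<notin> K \<longrightarrow> \<phi> (t, x) = 0)"
proof -
  show "continuous_on UNIV (\<lambda>t. \<phi>t (t, x))"
    by (rule continuous_on_compose2[OF test_continuous(2)]) (auto intro!: continuous_intros)
  obtain K where K: "compact K" "\<And>p. p \<notin> K \<Longrightarrow> \<phi> p = 0" using test_compact_support by metis
  moreover have "compact (fst ` K)" using K(1) by (intro compact_continuous_image continuous_intros)
  ultimately show "\<exists>K. compact K \<and> (\<forall>t. t \<notin> K \<longrightarrow> \<phi> (t, x) = 0)" by force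
qed

lemma test_slice_x:
  shows "continuous_on UNIV (\<lambda>x. \<phi> (t, x))" "continuous_on UNIV (\<lambda>x. \<phi>x (t, x))"
    "\<exists>K. compact K \<and> (\<forall>x. x \<notin> K \<longrightarrow> \<phi> (t, x) = 0)"
proof -
  show "continuous_on UNIV (\<lambda>x. \<phi> (t, x))"
    by (rule continuous_on_compose2[OF test_continuous(1)]) (auto intro!: continuous_intros)
  show "continuous_on UNIV (\<lambda>x. \<phi>x (t, x))"
    by (rule continuous_on_compose2[OF test_continuous(3)]) (auto intro!: continuous_intros)
  obtain K where K: "compact K" "\<And>p. p \<notin> K \<Longrightarrow> \<phi> p = 0" using test_compact_support by metis
  moreover have "compact (snd ` K)" using K(1) by (intro compact_continuous_image continuous_intros)
  ultimately show "\<exists>K. compact K \<and> (\<forall>x. x \<notin> K \<longrightarrow> \<phi> (t, x) = 0)" by force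
qed

lemma test_initial_integrable:
  fixes b :: "real \<Rightarrow> 'b::euclidean_space"
  assumes "b \<in> borel_measurable lborel" "\<And>x. norm (b x) \<le> B"
  shows "integrable lborel (\<lambda>x. \<phi> (0, x) *\<^sub>R b x)"
  using test_slice_x[of 0] assms by (metis integrable_compact_support_scaleR)

text \<open>Integrating in t before x leaves only the boundary value at t = 0, the term that the
  initial data will cancel. The set X is a parameter because both the whole line (constant
  background) and the half line (wedges) occur.\<close>

lemma integral_halfspace_t:
  assumes X: "X \<in> sets lborel"
  shows "(LINT p|lborel. \<phi>t p * (indicator {0<..} (fst p) * indicator X (snd p)))
       = - (LINT x|lborel. \<phi> (0, x) * indicator X x)"
proof -
  note [measurable] = X
  have "(\<lambda>p::real\<times>real. indicator {0<..} (fst p) * indicator X (snd p) :: real)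
      \<in> borel_measurable lborel"
    using X by (simp add: lborel_prod[symmetric])
  then have "integrable lborel (\<lambda>p. \<phi>t p * (indicator {0<..} (fst p) * indicator X (snd p)))"
    by (rule test_integrable(1)[where B = 1]) (auto simp: indicator_def)
  note lborel_Fubini(2)[OF this]
  moreover have "(LINT t|lborel. \<phi>t (t, x) * (indicator {0<..} t * indicator X x)) =
     - \<phi> (0, x) * indicator X x" for x
  proof -
    have "(LINT t|lborel. \<phi>t (t, x) * (indicator {0<..} t * indicator X x))
        = (LINT t|lborel. (\<phi>t (t, x) * indicator {0..} t) * indicator X x)"
    proof (rule integral_cong_AE)
      have m: "(\<lambda>t. \<phi>t (t, x)) \<in> borel_measurable borel"
        using test_slice_t(1) by (rule borel_measurable_continuous_onI)
      show "(\<lambda>t. \<phi>t (t, x) * (indicator {0<..} t * indicator X x)) \<in> borel_measurable lborel"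
        "(\<lambda>t. (\<phi>t (t, x) * indicator {0..} t) * indicator X x) \<in> borel_measurable lborel"
        using m by measurable
      show "AE t in lborel. \<phi>t (t, x) * (indicator {0<..} t * indicator X x)
         = (\<phi>t (t, x) * indicator {0..} t) * indicator X x"
        using AE_pos_iff_nonneg by eventually_elim (auto simp: indicator_def)
    qed
    also have "\<dots> = - \<phi> (0, x) * indicator X x"
      using integral_deriv_halfline[OF test_deriv_t test_slice_t(1), where c = 0] test_slice_t(2)[of x]
      by auto
    finally show ?thesis .
  qed
  ultimately show ?thesis by simp
qed

lemma integral_halfspace_x:
  "(LINT p|lborel. \<phi>x p * indicator {0<..} (fst p)) = 0"
proof -
  have "(\<lambda>p::real\<times>real. indicator {0<..} (fst p) :: real) \<in> borel_measurable lborel"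
    by (simp add: lborel_prod[symmetric])
  then have "integrable lborel (\<lambda>p. \<phi>x p * indicator {0<..} (fst p))"
    by (rule test_integrable(2)[where B = 1]) (auto simp: indicator_def)
  note lborel_Fubini(1)[OF this]
  moreover have "(LINT x|lborel. \<phi>x (t, x)) = 0" for t
    using integral_deriv_line[OF test_deriv_x test_slice_x(2)] test_slice_x(3)[of t] by metis
  ultimately show ?thesis by simp
qed

lemma integral_quadrant_x:
  "(LINT p|lborel. \<phi>x p * (indicator {0<..} (fst p) * indicator {0..} (snd p)))
     = - (LINT t|lborel. \<phi> (t, 0) * indicator {0<..} t)"
proof -
  have "(\<lambda>p::real\<times>real. indicator {0<..} (fst p) * indicator {0..} (snd p) :: real) \<in> borel_measurable lborel"
    by (simp add: lborel_prod[symmetric])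
  then have "integrable lborel (\<lambda>p. \<phi>x p * (indicator {0<..} (fst p) * indicator {0..} (snd p)))"
    by (rule test_integrable(2)[where B = 1]) (auto simp: indicator_def)
  note lborel_Fubini(1)[OF this]
  moreover have "(LINT x|lborel. \<phi>x (t, x) * indicator {0..} x) = - \<phi> (t, 0)" for t
    using integral_deriv_halfline[OF test_deriv_x test_slice_x(2), where c = 0] test_slice_x(3)[of t] by metis
  moreover have "(LINT x|lborel. \<phi>x (t, x) * (indicator {0<..} t * indicator {0..} x))
     = (LINT x|lborel. \<phi>x (t, x) * indicator {0..} x) * indicator {0<..} t" for t
    by (simp add: algebra_simps flip: integral_mult_right_zero)
  ultimately show ?thesis by simp
qed

text \<open>A shear turns any wedge into a quadrant. As test functions are closed under it, the
  quadrant formulas serve for all speeds.\<close>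

lemma test_function_shear:
  "test_function (\<lambda>p. \<phi> (fst p, snd p + fst p * \<sigma>))
     (\<lambda>p. \<phi>t (fst p, snd p + fst p * \<sigma>) + \<sigma> * \<phi>x (fst p, snd p + fst p * \<sigma>))
     (\<lambda>p. \<phi>x (fst p, snd p + fst p * \<sigma>))"
proof -
  let ?T = "\<lambda>p::real\<times>real. (fst p, snd p + fst p * \<sigma>)"
  have T: "continuous_on UNIV ?T" by (intro continuous_intros)
  have "((\<lambda>p. \<phi> (?T p)) has_derivative
     (\<lambda>d. (\<phi>t (?T p) + \<sigma> * \<phi>x (?T p)) * fst d + \<phi>x (?T p) * snd d)) (at p)" for p
  proof -
    have "(?T has_derivative (\<lambda>d. (fst d, snd d + fst d * \<sigma>))) (at p)"
      by (auto intro!: derivative_eq_intros)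
    from has_derivative_compose[OF this test_has_derivative] show ?thesis
      by (rule has_derivative_eq_rhs) (auto simp: algebra_simps)
  qed
  moreover have "continuous_on UNIV (\<lambda>p. \<phi>t (?T p) + \<sigma> * \<phi>x (?T p))"
    "continuous_on UNIV (\<lambda>p. \<phi>x (?T p))"
    using continuous_on_compose2[OF test_continuous(2) T]
      continuous_on_compose2[OF test_continuous(3) T]
    by (auto intro!: continuous_intros)
  moreover have "\<exists>K. compact K \<and> (\<forall>p. p \<notin> K \<longrightarrow> \<phi> (?T p) = 0)"
  proof -
    obtain K where K: "compact K" "\<And>p. p \<notin> K \<Longrightarrow> \<phi> p = 0" using test_compact_support by metis
    \<comment> \<open>The inverse shear, which carries K to a set supporting the sheared
      function.\<close>
    let ?S = "\<lambda>p::real\<times>real. (fst p, snd p - fst p * \<sigma>)"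
    have "compact (?S ` K)" using K(1) by (intro compact_continuous_image continuous_intros)
    moreover have "\<phi> (?T p) = 0" if "p \<notin> ?S ` K" for p
    proof (rule K(2), rule notI)
      assume "?T p \<in> K"
      then have "?S (?T p) \<in> ?S ` K" by (rule imageI)
      with that show False by simp
    qed
    ultimately show ?thesis by blast
  qed
  ultimately show ?thesis unfolding test_function_def by blast
qed

end

section \<open>Wedges and the weak form as a sum of jump defects\<close>

definition ray_integral :: "(real \<times> real \<Rightarrow> real) \<Rightarrow> real \<Rightarrow> real" where
  "ray_integral \<phi> \<sigma> = (LINT t|lborel. \<phi> (t, t * \<sigma>) * indicator {0<..} t)"

text \<open>Closed along the ray, to match the strict \<open>x < t * s\<close> in the solution
  formulas: these then equal sums of wedges at every point with t > 0, not just almost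
  everywhere.\<close>

definition wedge :: "real \<Rightarrow> real \<times> real \<Rightarrow> real" where
  "wedge \<sigma> p = (if 0 < fst p \<and> fst p * \<sigma> \<le> snd p then 1 else 0)"

lemma wedge_measurable_fixed: "wedge \<sigma> \<in> borel_measurable lborel"
  unfolding wedge_def by (simp add: borel_prod[symmetric] split_beta')

text \<open>In sheared coordinates the time derivative of the test function is
  \<open>\<phi>t + \<sigma> * \<phi>x\<close>; taking the second summand away again is what produces
  the term with factor \<sigma>.\<close>

lemma integral_wedge:
  assumes test: "test_function \<phi> \<phi>t \<phi>x"
  shows "(LINT p|lborel. \<phi>x p * wedge \<sigma> p) = - ray_integral \<phi> \<sigma>"
    and "(LINT p|lborel. \<phi>t p * wedge \<sigma> p)
       = \<sigma> * ray_integral \<phi> \<sigma> - (LINT x|lborel. \<phi> (0, x) * indicator {0..} x)"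
proof -
  let ?T = "\<lambda>p::real\<times>real. (fst p, snd p + fst p * \<sigma>)"
  let ?Q = "\<lambda>p::real\<times>real. indicator {0<..} (fst p) * indicator {0..} (snd p) :: real"
  note test' = test_function_shear[OF test, of \<sigma>]
  have w: "wedge \<sigma> (?T p) = ?Q p" for p by (simp add: wedge_def indicator_def)
  have Q: "?Q \<in> borel_measurable lborel" "\<And>p. \<bar>?Q p\<bar> \<le> 1"
    by (auto simp: lborel_prod[symmetric] indicator_def)
  have W: "wedge \<sigma> \<in> borel_measurable lborel" "\<And>p. \<bar>wedge \<sigma> p\<bar> \<le> 1"
    by (rule wedge_measurable_fixed) (simp add: wedge_def)
  note ix = test_integrable(2)[OF test' Q] and it' = test_integrable(1)[OF test' Q]
  have it: "integrable lborel (\<lambda>p. \<phi>t (?T p) * ?Q p)"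
    using Bochner_Integration.integrable_diff[OF it' integrable_mult_right[OF ix, of \<sigma>]]
    by (simp add: algebra_simps)
  have shx: "(LINT p|lborel. \<phi>x p * wedge \<sigma> p) = (LINT p|lborel. \<phi>x (?T p) * ?Q p)"
    using integral_lborel_shear[OF test_integrable(2)[OF test W], of \<sigma>] ix unfolding w by simp
  also have "\<dots> = - ray_integral \<phi> \<sigma>"
    using integral_quadrant_x[OF test'] by (simp add: ray_integral_def)
  finally show x: "(LINT p|lborel. \<phi>x p * wedge \<sigma> p) = - ray_integral \<phi> \<sigma>" .
  have "(LINT p|lborel. \<phi>t p * wedge \<sigma> p) = (LINT p|lborel. \<phi>t (?T p) * ?Q p)"
    using integral_lborel_shear[OF test_integrable(1)[OF test W], of \<sigma>] it unfolding w by simp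
  also have "\<dots> = (LINT p|lborel. (\<phi>t (?T p) + \<sigma> * \<phi>x (?T p)) * ?Q p - \<sigma> * (\<phi>x (?T p) * ?Q p))"
    by (simp add: algebra_simps)
  also have "\<dots> = (LINT p|lborel. (\<phi>t (?T p) + \<sigma> * \<phi>x (?T p)) * ?Q p)
      - \<sigma> * (LINT p|lborel. \<phi>x (?T p) * ?Q p)"
    using it' ix by simp
  also have "\<dots> = \<sigma> * ray_integral \<phi> \<sigma> - (LINT x|lborel. \<phi> (0, x) * indicator {0..} x)"
    using integral_halfspace_t[OF test', of "{0..}"] x shx by simp
  finally show "(LINT p|lborel. \<phi>t p * wedge \<sigma> p)
       = \<sigma> * ray_integral \<phi> \<sigma> - (LINT x|lborel. \<phi> (0, x) * indicator {0..} x)" .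
qed

text \<open>The product f(p) k(r) is integrable and a wedge is bounded by 1, so Fubini applies. Here
  k is the signed density of jumps over the layers r; measurability of \<sigma> makes the wedge
  jointly measurable in p and r.\<close>

lemma wedge_fan:
  fixes f :: "real \<times> real \<Rightarrow> real" and k \<sigma> :: "real \<Rightarrow> real"
  assumes f: "integrable lborel f" and k: "integrable lborel k"
    and \<sigma>: "\<sigma> \<in> borel_measurable borel"
  shows integrable_mult_wedge_fan:
      "integrable lborel (\<lambda>p. f p * (LINT r|lborel. k r * wedge (\<sigma> r) p))"
    and integrable_fan_mult_wedge:
      "integrable lborel (\<lambda>r. k r * (LINT p|lborel. f p * wedge (\<sigma> r) p))"
    and integral_mult_wedge_fan:
      "(LINT p|lborel. f p * (LINT r|lborel. k r * wedge (\<sigma> r) p))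
        = (LINT r|lborel. k r * (LINT p|lborel. f p * wedge (\<sigma> r) p))"
proof -
  note [measurable] = \<sigma> borel_measurable_integrable[OF f, simplified]
    borel_measurable_integrable[OF k, simplified]
  have fk: "integrable (lborel \<Otimes>\<^sub>M lborel) (\<lambda>(p, r). f p * k r)"
  proof (rule lborel_pair.Fubini_integrable)
    show "integrable lborel (\<lambda>p. LINT r|lborel. norm (case (p, r) of (p, r) \<Rightarrow> f p * k r))"
      using f k by (simp add: abs_mult)
    show "AE p in lborel. integrable lborel (\<lambda>r. case (p, r) of (p, r) \<Rightarrow> f p * k r)"
      using k by simp
  qed measurable
  have fkw: "integrable (lborel \<Otimes>\<^sub>M lborel) (\<lambda>(p, r). f p * k r * wedge (\<sigma> r) p)"
  proof (rule Bochner_Integration.integrable_bound[OF fk])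
    have [measurable]: "(\<lambda>(p, r). wedge (\<sigma> r) p) \<in> borel_measurable (lborel \<Otimes>\<^sub>M lborel)"
    proof -
      have "(\<lambda>(p, r). wedge (\<sigma> r) p) \<in> borel_measurable ((borel \<Otimes>\<^sub>M borel) \<Otimes>\<^sub>M borel)"
        unfolding wedge_def split_beta' by measurable
      then show ?thesis
        unfolding borel_prod by (simp add: lborel_prod)
    qed
    show "(\<lambda>(p, r). f p * k r * wedge (\<sigma> r) p) \<in> borel_measurable (lborel \<Otimes>\<^sub>M lborel)"
      by measurable
  qed (auto simp: abs_mult wedge_def)
  have 1: "(LINT r|lborel. f p * k r * wedge (\<sigma> r) p) = f p * (LINT r|lborel. k r * wedge (\<sigma> r) p)" for p
    by (simp add: mult.assoc)
  have 2: "(LINT p|lborel. f p * k r * wedge (\<sigma> r) p) = k r * (LINT p|lborel. f p * wedge (\<sigma> r) p)" for r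
    by (simp add: mult.assoc mult.left_commute[of "f _"])
  show "integrable lborel (\<lambda>p. f p * (LINT r|lborel. k r * wedge (\<sigma> r) p))"
    using lborel_pair.integrable_fst[OF fkw] by (simp add: 1)
  show "integrable lborel (\<lambda>r. k r * (LINT p|lborel. f p * wedge (\<sigma> r) p))"
    using lborel_pair.integrable_snd[OF fkw] by (simp add: 2)
  show "(LINT p|lborel. f p * (LINT r|lborel. k r * wedge (\<sigma> r) p))
        = (LINT r|lborel. k r * (LINT p|lborel. f p * wedge (\<sigma> r) p))"
    using lborel_pair.Fubini_integral[OF fkw] by (simp add: 1 2)
qed

text \<open>Two wedges are enough: shock and contact, or only the contact besides a fan. The flux
  density \<open>\<sigma> r * k r\<close> says that each layer obeys its own jump condition, so the
  fan drops out. The hypothesis \<open>init\<close> says that all jumps add up to the jump of the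
  data, so everything at t = 0 cancels.\<close>

lemma weak_form_self_similar:
  fixes A B :: "'a \<Rightarrow> real" and k \<sigma> :: "real \<Rightarrow> real"
  assumes test: "test_function \<phi> \<phi>t \<phi>x"
    and k: "integrable lborel k" "integrable lborel (\<lambda>r. \<sigma> r * k r)"
    and \<sigma>: "\<sigma> \<in> borel_measurable borel"
    and A: "\<And>t x. 0 < t \<Longrightarrow> A (u t x) = A0 + c1 * wedge s1 (t, x) + c2 * wedge s2 (t, x)
              + (LINT r|lborel. k r * wedge (\<sigma> r) (t, x))"
    and B: "\<And>t x. 0 < t \<Longrightarrow> B (u t x) = B0 + e1 * wedge s1 (t, x) + e2 * wedge s2 (t, x)
              + (LINT r|lborel. \<sigma> r * k r * wedge (\<sigma> r) (t, x))"
    and init: "\<And>x. A (u0 x) = A0 + (c1 + c2 + (LINT r|lborel. k r)) * indicator {0..} x"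
  shows "weak_form A B u0 u \<phi> \<phi>t \<phi>x
     = (s1 * c1 - e1) * ray_integral \<phi> s1 + (s2 * c2 - e2) * ray_integral \<phi> s2"
proof -
  let ?P = "\<lambda>p::real\<times>real. indicator {0<..} (fst p) :: real"
  let ?G = "ray_integral \<phi>"
  define H where "H = (LINT x|lborel. \<phi> (0, x) * indicator {0..} x)"
  define I where "I = (LINT x|lborel. \<phi> (0, x))"
  have Pm: "?P \<in> borel_measurable lborel" "\<And>p. \<bar>?P p\<bar> \<le> 1"
    by (auto simp: lborel_prod[symmetric] indicator_def)
  have W: "wedge \<sigma> \<in> borel_measurable lborel" "\<And>p. \<bar>wedge \<sigma> p\<bar> \<le> 1" for \<sigma>
    by (rule wedge_measurable_fixed) (simp add: wedge_def)
  note int = test_integrable[OF test Pm] test_integrable[OF test W]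
  have f: "integrable lborel \<phi>t" "integrable lborel \<phi>x"
    using test_integrable[OF test, of "\<lambda>_. 1" 1] by auto
  note fan = wedge_fan[OF f(1) k(1) \<sigma>] wedge_fan[OF f(2) k(2) \<sigma>]
  note wi = integral_wedge[OF test, folded H_def]
  have PI: "(LINT p|lborel. \<phi>t p * ?P p) = - I"
    using integral_halfspace_t[OF test, of UNIV] by (simp add: I_def)
  have Px: "(LINT p|lborel. \<phi>x p * ?P p) = 0" by (rule integral_halfspace_x[OF test])
  have "(LINT p:{p. 0 < fst p}|lborel.
        \<phi>t p *\<^sub>R A (u (fst p) (snd p)) + \<phi>x p *\<^sub>R B (u (fst p) (snd p)))
     = (LINT p|lborel. (A0 * (\<phi>t p * ?P p) + c1 * (\<phi>t p * wedge s1 p) + c2 * (\<phi>t p * wedge s2 p)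
          + \<phi>t p * (LINT r|lborel. k r * wedge (\<sigma> r) p))
        + (B0 * (\<phi>x p * ?P p) + e1 * (\<phi>x p * wedge s1 p) + e2 * (\<phi>x p * wedge s2 p)
          + \<phi>x p * (LINT r|lborel. \<sigma> r * k r * wedge (\<sigma> r) p)))"
    unfolding set_lebesgue_integral_def
  proof (rule Bochner_Integration.integral_cong[OF refl])
    fix p :: "real \<times> real"
    show "indicator {p. 0 < fst p} p *\<^sub>R
       (\<phi>t p *\<^sub>R A (u (fst p) (snd p)) + \<phi>x p *\<^sub>R B (u (fst p) (snd p)))
     = (A0 * (\<phi>t p * ?P p) + c1 * (\<phi>t p * wedge s1 p) + c2 * (\<phi>t p * wedge s2 p)
          + \<phi>t p * (LINT r|lborel. k r * wedge (\<sigma> r) p))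
        + (B0 * (\<phi>x p * ?P p) + e1 * (\<phi>x p * wedge s1 p) + e2 * (\<phi>x p * wedge s2 p)
          + \<phi>x p * (LINT r|lborel. \<sigma> r * k r * wedge (\<sigma> r) p))"
    proof (cases "0 < fst p")
      case True
      with A[of "fst p" "snd p"] B[of "fst p" "snd p"] show ?thesis
        by (simp add: algebra_simps)
    next
      case False
      then have "wedge \<sigma> p = 0" for \<sigma> by (simp add: wedge_def)
      with False show ?thesis by simp
    qed
  qed
  also have "\<dots> = - A0 * I + c1 * (s1 * ?G s1 - H) + c2 * (s2 * ?G s2 - H)
        + (LINT r|lborel. k r * (\<sigma> r * ?G (\<sigma> r) - H))
        - e1 * ?G s1 - e2 * ?G s2 - (LINT r|lborel. \<sigma> r * k r * ?G (\<sigma> r))"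
    using int fan(1,4) by (simp add: fan(3,6) wi PI Px)
  also have "(LINT r|lborel. k r * (\<sigma> r * ?G (\<sigma> r) - H))
      = (LINT r|lborel. \<sigma> r * k r * ?G (\<sigma> r) - k r * H)"
    by (simp add: algebra_simps)
  also have "\<dots> = (LINT r|lborel. \<sigma> r * k r * ?G (\<sigma> r)) - (LINT r|lborel. k r) * H"
    using fan(5) k(1) by (simp add: wi)
  \<comment> \<open>The ray integrals of the layers from the density part cancel those from the flux
    part; of the fan only its total jump times H remains.\<close>
  finally have "(LINT p:{p. 0 < fst p}|lborel.
        \<phi>t p *\<^sub>R A (u (fst p) (snd p)) + \<phi>x p *\<^sub>R B (u (fst p) (snd p)))
     = - A0 * I + c1 * (s1 * ?G s1 - H) + c2 * (s2 * ?G s2 - H)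
        - (LINT r|lborel. k r) * H - e1 * ?G s1 - e2 * ?G s2"
    by simp
  moreover have "(LINT x|lborel. \<phi> (0, x) *\<^sub>R A (u0 x))
      = (LINT x|lborel. A0 * \<phi> (0, x)
          + (c1 + c2 + (LINT r|lborel. k r)) * (\<phi> (0, x) * indicator {0..} x))"
    by (simp add: init algebra_simps)
  moreover have "\<dots> = A0 * I + (c1 + c2 + (LINT r|lborel. k r)) * H"
    using test_initial_integrable[OF test, of "\<lambda>_. 1::real" 1]
      test_initial_integrable[OF test, of "indicator {0..} :: real \<Rightarrow> real" 1]
    by (simp add: I_def H_def)
  ultimately show ?thesis
    by (simp add: weak_form_def algebra_simps)
qed

lemma ray_integral_nonneg:
  assumes "\<And>p. 0 \<le> \<phi> p"
  shows "0 \<le> ray_integral \<phi> \<sigma>"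
  unfolding ray_integral_def using assms by (intro Bochner_Integration.integral_nonneg) simp

section \<open>From entropy production on one ray to entropy weak solutions\<close>

lemma convex_entropy_pair_linear:
  fixes f :: "'a::euclidean_space \<Rightarrow> 'a"
  assumes "convex \<Omega>" and f: "\<And>u. u \<in> \<Omega> \<Longrightarrow> f differentiable (at u)"
  shows "convex_entropy_pair \<Omega> f (\<lambda>u. b \<bullet> u) (\<lambda>u. b \<bullet> f u)"
  unfolding convex_entropy_pair_def
proof (intro conjI exI[of _ "\<lambda>_. b"] ballI)
  show "convex_on \<Omega> ((\<bullet>) b)"
    using assms(1) by (auto simp: convex_on_def inner_add_right)
  show "((\<bullet>) b has_derivative (\<bullet>) b) (at u)" for u
    by (intro bounded_linear_imp_has_derivative bounded_linear_inner_right)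
  show "((\<lambda>u. b \<bullet> f u) has_derivative (\<lambda>k. b \<bullet> frechet_derivative f (at u) k)) (at u)"
    if "u \<in> \<Omega>" for u
    using f[OF that] by (intro has_derivative_inner_right) (simp add: frechet_derivative_works)
qed simp

text \<open>The conserved quantities themselves are entropies of both signs, so the entropy production
  along the single ray \<open>x = \<sigma> t\<close> vanishes for them.\<close>

lemma entropy_weak_solutionI:
  fixes f :: "'a::euclidean_space \<Rightarrow> 'a" and u :: "real \<Rightarrow> real \<Rightarrow> 'a"
  assumes \<Omega>: "convex \<Omega>" and f: "\<And>u. u \<in> \<Omega> \<Longrightarrow> f differentiable (at u)"
    and u0: "u0 \<in> borel_measurable lborel"
    and u: "set_borel_measurable lborel {p. 0 < fst p} (\<lambda>p. u (fst p) (snd p))"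
    and K: "compact K" "K \<subseteq> \<Omega>" "\<And>x. u0 x \<in> K" "\<And>t x. 0 < t \<Longrightarrow> u t x \<in> K"
    and pairs: "\<And>\<eta> q. convex_entropy_pair \<Omega> f \<eta> q \<Longrightarrow>
      \<exists>c\<ge>0. \<forall>\<phi> \<phi>t \<phi>x. test_function \<phi> \<phi>t \<phi>x \<longrightarrow>
        weak_form \<eta> q u0 u \<phi> \<phi>t \<phi>x = c * ray_integral \<phi> \<sigma>"
  shows "entropy_weak_solution \<Omega> f u0 u"
proof -
  have "weak_form (\<lambda>v. v) f u0 u \<phi> \<phi>t \<phi>x = 0" if test: "test_function \<phi> \<phi>t \<phi>x" for \<phi> \<phi>t \<phi>x
  proof -
    let ?S = "{p :: real \<times> real. 0 < fst p}"
    define U where "U p = indicator ?S p *\<^sub>R u (fst p) (snd p)" for p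
    define V where "V p = indicator ?S p *\<^sub>R f (u (fst p) (snd p))" for p
    have Um: "U \<in> borel_measurable lborel"
      using u unfolding set_borel_measurable_def U_def by simp
    have fc: "continuous_on K f"
      using f K(2) by (intro continuous_at_imp_continuous_on) (auto intro: differentiable_imp_continuous_within)
    have g: "(\<lambda>v. indicator K v *\<^sub>R f v) \<in> borel_measurable borel"
      using K(1) fc by (intro borel_measurable_continuous_on_indicator) (auto intro: borel_compact)
    \<comment> \<open>Nothing is assumed about f outside \<Omega>. Cut off at K it is Borel on the
      whole space, and V is obtained by composing this cut-off with U.\<close>
    have "V = (\<lambda>p. indicator ?S p *\<^sub>R (indicator K (U p) *\<^sub>R f (U p)))"
      using K(4) by (auto simp: V_def U_def indicator_def fun_eq_iff)
    moreover have "?S \<in> sets lborel"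
      by (simp add: borel_open open_Collect_less continuous_on_const continuous_on_fst continuous_on_id)
    ultimately have Vm: "V \<in> borel_measurable lborel"
      using borel_measurable_scaleR[OF borel_measurable_indicator measurable_compose[OF Um, of _ borel]] g
      by (simp del: scaleR_scaleR)
    obtain B where B: "\<And>v. v \<in> K \<Longrightarrow> norm v \<le> B"
      using compact_imp_bounded[OF K(1)] unfolding bounded_iff by blast
    obtain C where C: "\<And>v. v \<in> K \<Longrightarrow> norm (f v) \<le> C"
      using compact_imp_bounded[OF compact_continuous_image[OF fc K(1)]]
      unfolding bounded_iff by blast
    have "0 \<le> B" "0 \<le> C"
      using order_trans[OF norm_ge_zero B[OF K(3)]] order_trans[OF norm_ge_zero C[OF K(3)]] by auto
    then have "norm (U p) \<le> B" "norm (V p) \<le> C" for p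
      using B C K(4) by (auto simp: U_def V_def indicator_def)
    note int = test_integrable_scaleR(1)[OF test Um this(1)] test_integrable_scaleR(2)[OF test Vm this(2)]
      test_initial_integrable[OF test u0 B[OF K(3)]]
    define I where "I = (LINT p|lborel. \<phi>t p *\<^sub>R U p + \<phi>x p *\<^sub>R V p)
        + (LINT x|lborel. \<phi> (0, x) *\<^sub>R u0 x)"
    have I: "weak_form (\<lambda>v. v) f u0 u \<phi> \<phi>t \<phi>x = I"
      by (simp add: weak_form_def I_def U_def V_def set_lebesgue_integral_def
          scaleR_add_right mult.commute)
    have comp: "weak_form (\<lambda>v. b \<bullet> v) (\<lambda>v. b \<bullet> f v) u0 u \<phi> \<phi>t \<phi>x = b \<bullet> I" for b
    proof -
      have "b \<bullet> (LINT p|lborel. \<phi>t p *\<^sub>R U p + \<phi>x p *\<^sub>R V p)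
          = (LINT p|lborel. b \<bullet> (\<phi>t p *\<^sub>R U p + \<phi>x p *\<^sub>R V p))"
        by (rule integral_inner_right[symmetric]) (use int in simp)
      moreover have "b \<bullet> (LINT x|lborel. \<phi> (0, x) *\<^sub>R u0 x)
          = (LINT x|lborel. b \<bullet> (\<phi> (0, x) *\<^sub>R u0 x))"
        by (rule integral_inner_right[symmetric]) (use int in simp)
      ultimately have "b \<bullet> I = (LINT p|lborel. b \<bullet> (\<phi>t p *\<^sub>R U p + \<phi>x p *\<^sub>R V p))
        + (LINT x|lborel. b \<bullet> (\<phi> (0, x) *\<^sub>R u0 x))"
        by (simp only: I_def inner_add_right)
      then show ?thesis
        by (simp add: weak_form_def U_def V_def set_lebesgue_integral_def inner_add_right algebra_simps)
    qed
    have "b \<bullet> I = 0" for b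
    proof -
      obtain c where c: "0 \<le> c" "b \<bullet> I = c * ray_integral \<phi> \<sigma>"
        using pairs[OF convex_entropy_pair_linear[OF \<Omega> f], of b] test comp by metis
      obtain c' where c': "0 \<le> c'" "(- b) \<bullet> I = c' * ray_integral \<phi> \<sigma>"
        using pairs[OF convex_entropy_pair_linear[OF \<Omega> f], of "- b"] test
        unfolding comp[symmetric] by blast
      \<comment> \<open>With both coefficients nonnegative, a zero product means that either
        \<open>c = 0\<close> or the ray integral vanishes; no sign of \<phi> is needed.\<close>
      have "(c + c') * ray_integral \<phi> \<sigma> = 0" using c(2) c'(2) by (simp add: distrib_right)
      with c c'(1) show ?thesis by auto
    qed
    from this[of I] show ?thesis unfolding I by simp
  qed
  moreover have "0 \<le> weak_form \<eta> q u0 u \<phi> \<phi>t \<phi>x"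
    if "convex_entropy_pair \<Omega> f \<eta> q" "test_function \<phi> \<phi>t \<phi>x" "\<forall>p. 0 \<le> \<phi> p" for \<eta> q \<phi> \<phi>t \<phi>x
    using pairs[OF that(1)] that(2,3) ray_integral_nonneg[of \<phi> \<sigma>] by auto
  ultimately show ?thesis
    unfolding entropy_weak_solution_def weak_solution_def
    using u0 u K by (intro conjI exI[of _ K]) auto
qed

section \<open>The traffic flow system\<close>

lemma has_vector_derivative_zero_endpoints:
  fixes f :: "real \<Rightarrow> 'a::real_normed_vector"
  assumes "\<And>x. x \<in> {a..b} \<Longrightarrow> (f has_vector_derivative 0) (at x within {a..b})" "a \<le> b"
  shows "f b = f a"
proof -
  obtain k where "\<And>x. x \<in> {a..b} \<Longrightarrow> f x = k"
    using has_vector_derivative_zero_constant[OF convex_real_interval(5) assms(1)] by blast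
  then show ?thesis using assms(2) by simp
qed

lemma hugoniot_locusE:
  fixes u0 :: "'a::euclidean_space"
  assumes "u \<in> hugoniot_locus \<Omega> f lam u0"
  obtains "u = u0" | c :: "real \<Rightarrow> 'a" and s :: "real \<Rightarrow> real" where "continuous_on {0..1} c" "continuous_on {0..1} s"
    "c 0 = u0" "c 1 = u" "s 0 = lam u0"
    "\<And>\<tau>. \<tau> \<in> {0<..1} \<Longrightarrow> c \<tau> \<in> \<Omega> \<and> c \<tau> \<noteq> u0 \<and> rankine_hugoniot f u0 (c \<tau>) (s \<tau>)"
proof (cases "u = u0")
  case False
  with assms have "\<exists>(c :: real \<Rightarrow> 'a) (s :: real \<Rightarrow> real). continuous_on {0..1} c \<and> continuous_on {0..1} s \<and>
      c 0 = u0 \<and> c 1 = u \<and> s 0 = lam u0 \<and>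
      (\<forall>\<tau>\<in>{0<..1}. c \<tau> \<in> \<Omega> \<and> c \<tau> \<noteq> u0 \<and> rankine_hugoniot f u0 (c \<tau>) (s \<tau>))"
    by (simp add: hugoniot_locus_def)
  then show thesis using that(2) by (elim exE conjE) blast
qed (rule that(1))

lemma phase_space_alt: "phase_space = {u. 0 < fst u}"
  by (auto simp: phase_space_def)

lemma convex_phase_space: "convex phase_space"
proof -
  have "phase_space = fst -` {0::real<..}" by (auto simp: phase_space_alt)
  moreover have "convex (fst -` {0::real<..} :: state set)"
    by (intro convex_linear_vimage) (auto simp: linear_fst)
  ultimately show ?thesis by simp
qed

text \<open>The factor 1/\<gamma> in the pressure makes both branches share one derivative, which
  spares most of what follows a case distinction in \<gamma>.\<close>

lemma pressure_has_derivative: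
  assumes "0 < \<rho>"
  shows "(pressure \<gamma> has_field_derivative \<rho> powr (\<gamma> - 1)) (at \<rho>)"
proof -
  have "((\<lambda>\<rho>. if \<gamma> = 0 then ln \<rho> else \<rho> powr \<gamma> / \<gamma>) has_field_derivative \<rho> powr (\<gamma> - 1)) (at \<rho>)"
    using assms by (cases "\<gamma> = 0") (auto intro!: derivative_eq_intros simp: powr_minus divide_simps)
  then show ?thesis by (simp add: pressure_def[abs_def])
qed

lemma pressure_strict_mono:
  assumes "0 \<le> \<gamma>" "0 < x" "x < y"
  shows "pressure \<gamma> x < pressure \<gamma> y"
  using assms by (auto simp: pressure_def intro!: divide_strict_right_mono powr_less_mono2)

lemma pressure_less_iff:
  assumes "0 \<le> \<gamma>" "0 < x" "0 < y"
  shows "pressure \<gamma> x < pressure \<gamma> y \<longleftrightarrow> x < y"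
  using assms pressure_strict_mono[of \<gamma>] by (metis linorder_less_linear order_less_asym)

lemma pressure_inj:
  assumes "0 \<le> \<gamma>" "0 < x" "0 < y" "pressure \<gamma> x = pressure \<gamma> y"
  shows "x = y"
  using assms pressure_strict_mono[of \<gamma>] by (metis linorder_less_linear order_less_irrefl)

lemma velocity_alt: "velocity \<gamma> a u = fst (snd u) / fst u - a (snd (snd u) / fst u) * pressure \<gamma> (fst u)"
  by (simp add: velocity_def split_beta)

lemma lambda1_alt:
  assumes "0 < fst u"
  shows "lambda1 \<gamma> a u = velocity \<gamma> a u - a (snd (snd u) / fst u) * fst u powr \<gamma>"
proof -
  have "deriv (pressure \<gamma>) (fst u) * fst u = fst u powr \<gamma>"
    using DERIV_imp_deriv[OF pressure_has_derivative[OF assms]] assms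
    by (simp add: powr_diff)
  then show ?thesis by (simp add: lambda1_def split_beta mult.assoc)
qed

text \<open>Along a ray the system reduces to the scalar law with flux \<open>ray_flux\<close>, since both \<open>\<omega>\<close> and
  \<open>h\<close> are constant there.\<close>

definition ray :: "real \<Rightarrow> real \<Rightarrow> real \<Rightarrow> state" where
  "ray \<omega> h \<rho> = \<rho> *\<^sub>R (1, \<omega>, h)"

definition ray_flux :: "real \<Rightarrow> (real \<Rightarrow> real) \<Rightarrow> real \<Rightarrow> real \<Rightarrow> real \<Rightarrow> real" where
  "ray_flux \<gamma> a \<omega> h \<rho> = \<rho> * (\<omega> - a h * pressure \<gamma> \<rho>)"

text \<open>The derivative of \<open>ray_flux\<close> in the density, and thus \<lambda>1 restricted
  to a ray; the power is the product of density and P'.\<close>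

definition ray_speed :: "real \<Rightarrow> (real \<Rightarrow> real) \<Rightarrow> real \<Rightarrow> real \<Rightarrow> real \<Rightarrow> real" where
  "ray_speed \<gamma> a \<omega> h \<rho> = \<omega> - a h * (pressure \<gamma> \<rho> + \<rho> powr \<gamma>)"

lemma state_of_eq_ray: "state_of \<gamma> a \<rho> v h = ray (v + a h * pressure \<gamma> \<rho>) h \<rho>"
  by (simp add: state_of_def ray_def)

lemma ray_in_phase_space: "ray \<omega> h \<rho> \<in> phase_space \<longleftrightarrow> 0 < \<rho>"
  by (simp add: phase_space_alt ray_def)

lemma eq_ray:
  assumes "u \<in> phase_space"
  shows "u = ray (fst (snd u) / fst u) (snd (snd u) / fst u) (fst u)"
  using assms by (simp add: phase_space_alt ray_def prod_eq_iff)

lemma velocity_ray: "0 < \<rho> \<Longrightarrow> velocity \<gamma> a (ray \<omega> h \<rho>) = \<omega> - a h * pressure \<gamma> \<rho>"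
  by (simp add: velocity_def ray_def)

lemma velocity_state_of: "0 < \<rho> \<Longrightarrow> velocity \<gamma> a (state_of \<gamma> a \<rho> v h) = v"
  by (simp add: state_of_eq_ray velocity_ray)

lemma lambda1_ray: "0 < \<rho> \<Longrightarrow> lambda1 \<gamma> a (ray \<omega> h \<rho>) = ray_speed \<gamma> a \<omega> h \<rho>"
  by (subst lambda1_alt) (simp_all add: velocity_ray ray_speed_def ray_def algebra_simps velocity_def)

lemma eq_state_of:
  assumes "u \<in> phase_space"
  shows "u = state_of \<gamma> a (fst u) (velocity \<gamma> a u) (snd (snd u) / fst u)"
  using assms by (simp add: phase_space_alt state_of_def velocity_def prod_eq_iff split_beta)

lemma ray_flux_has_derivative:
  assumes "0 < \<rho>"
  shows "(ray_flux \<gamma> a \<omega> h has_field_derivative ray_speed \<gamma> a \<omega> h \<rho>) (at \<rho>)"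
proof -
  have "((\<lambda>\<rho>. \<rho> * (\<omega> - a h * pressure \<gamma> \<rho>)) has_field_derivative
      1 * (\<omega> - a h * pressure \<gamma> \<rho>) + (0 - a h * \<rho> powr (\<gamma> - 1)) * \<rho>) (at \<rho>)"
    by (intro derivative_intros DERIV_mult DERIV_cmult pressure_has_derivative assms)
  moreover have "1 * (\<omega> - a h * pressure \<gamma> \<rho>) + (0 - a h * \<rho> powr (\<gamma> - 1)) * \<rho> = ray_speed \<gamma> a \<omega> h \<rho>"
    using assms by (simp add: ray_speed_def powr_diff algebra_simps)
  ultimately show ?thesis
    unfolding ray_flux_def[abs_def] by simp
qed

lemma flux_ray: "0 < \<rho> \<Longrightarrow> flux \<gamma> a (ray \<omega> h \<rho>) = ray_flux \<gamma> a \<omega> h \<rho> *\<^sub>R (1, \<omega>, h)"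
  by (simp add: flux_def velocity_ray ray_flux_def) (simp add: ray_def)

text \<open>Both sides of the vector condition are multiples of (1, \<omega>, h), whose first
  component is nonzero, so the direction cancels.\<close>

lemma rankine_hugoniot_ray:
  assumes "0 < \<rho>" "0 < \<rho>'"
  shows "rankine_hugoniot (flux \<gamma> a) (ray \<omega> h \<rho>) (ray \<omega> h \<rho>') s
     \<longleftrightarrow> ray_flux \<gamma> a \<omega> h \<rho> - ray_flux \<gamma> a \<omega> h \<rho>' = s * (\<rho> - \<rho>')"
  unfolding rankine_hugoniot_def flux_ray[OF assms(1)] flux_ray[OF assms(2)]
  unfolding ray_def scaleR_diff_left[symmetric] scaleR_scaleR scaleR_cancel_right
  by (auto simp: prod_eq_iff)

text \<open>The secant slope of the flux along a ray is continuous up to the base point by Caratheodory.\<close>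

lemma ray_secant:
  assumes \<rho>0: "0 < \<rho>0"
  obtains g where "g \<rho>0 = ray_speed \<gamma> a \<omega> h \<rho>0" "continuous_on {0<..} g"
    "\<And>\<rho>. ray_flux \<gamma> a \<omega> h \<rho>0 - ray_flux \<gamma> a \<omega> h \<rho> = g \<rho> * (\<rho>0 - \<rho>)"
proof -
  let ?F = "ray_flux \<gamma> a \<omega> h"
  from ray_flux_has_derivative[OF \<rho>0, of \<gamma> a \<omega> h] obtain g where
    g: "\<And>z. ?F z - ?F \<rho>0 = g z * (z - \<rho>0)" "isCont g \<rho>0" "g \<rho>0 = ray_speed \<gamma> a \<omega> h \<rho>0"
    unfolding CARAT_DERIV by blast
  have "isCont g \<rho>" if \<rho>: "0 < \<rho>" for \<rho>
  proof (cases "\<rho> = \<rho>0")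
    case False
    have "isCont ?F \<rho>" using ray_flux_has_derivative[OF \<rho>] DERIV_isCont by blast
    then have "isCont (\<lambda>z. (?F z - ?F \<rho>0) / (z - \<rho>0)) \<rho>"
      using False by (intro continuous_intros) auto
    moreover have "\<forall>\<^sub>F z in nhds \<rho>. (?F z - ?F \<rho>0) / (z - \<rho>0) = g z"
      using t1_space_nhds[OF False] by eventually_elim (simp add: g(1))
    ultimately show ?thesis by (simp add: isCont_cong)
  qed (use g(2) in simp)
  then have "continuous_on {0<..} g" by (simp add: continuous_at_imp_continuous_on)
  moreover have "?F \<rho>0 - ?F \<rho> = g \<rho> * (\<rho>0 - \<rho>)" for \<rho> using g(1)[of \<rho>] by (simp add: algebra_simps)
  ultimately show thesis using that g(3) by blast
qed

locale traffic_model =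
  fixes \<gamma> :: real and a :: "real \<Rightarrow> real"
  assumes gamma: "0 \<le> \<gamma>" and a_pos: "0 < a h" and a_C1: "a C1_differentiable_on UNIV"
begin

text \<open>Strict concavity of the flux along a ray, i.e. genuine nonlinearity. Strictness comes
  from the pressure, since the power is constant for \<gamma> = 0.\<close>

lemma ray_speed_strict_antimono:
  assumes "0 < \<rho>" "\<rho> < \<rho>'"
  shows "ray_speed \<gamma> a \<omega> h \<rho>' < ray_speed \<gamma> a \<omega> h \<rho>"
proof -
  have "pressure \<gamma> \<rho> + \<rho> powr \<gamma> < pressure \<gamma> \<rho>' + \<rho>' powr \<gamma>"
    using assms gamma by (intro add_less_le_mono pressure_strict_mono powr_mono2) auto
  then show ?thesis using a_pos by (simp add: ray_speed_def)
qed

lemma ray_speed_le_iff: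
  assumes "0 < \<rho>" "0 < \<rho>'"
  shows "ray_speed \<gamma> a \<omega> h \<rho> \<le> ray_speed \<gamma> a \<omega> h \<rho>' \<longleftrightarrow> \<rho>' \<le> \<rho>"
  using ray_speed_strict_antimono assms by (metis leD le_less_linear order_le_less)

lemma lambda1_less_velocity:
  assumes "u \<in> phase_space"
  shows "lambda1 \<gamma> a u < velocity \<gamma> a u"
  using assms a_pos by (simp add: phase_space_alt lambda1_alt)

section \<open>Derivatives of velocity and flux, and the eigenvector fields\<close>

definition da :: "real \<Rightarrow> real" where "da h = vector_derivative a (at h)"

lemma da: "(a has_field_derivative da h) (at h)" "continuous_on UNIV da"
  using a_C1 by (auto simp: C1_differentiable_on_eq da_def[abs_def]
      has_real_derivative_iff_has_vector_derivative vector_derivative_works[symmetric])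

lemma continuous_on_a: "continuous_on S a"
  using da(1) DERIV_isCont continuous_at_imp_continuous_on by blast

definition dvel :: "state \<Rightarrow> state \<Rightarrow> real" where
  "dvel u d = fst (snd d) / fst u - fst (snd u) * fst d / (fst u)\<^sup>2
     - da (snd (snd u) / fst u) * (snd (snd d) / fst u - snd (snd u) * fst d / (fst u)\<^sup>2) * pressure \<gamma> (fst u)
     - a (snd (snd u) / fst u) * (fst u powr (\<gamma> - 1) * fst d)"

lemma velocity_has_derivative:
  assumes "u \<in> phase_space"
  shows "(velocity \<gamma> a has_derivative dvel u) (at u)"
proof -
  have u: "0 < fst u" using assms by (simp add: phase_space_alt)
  have d: "(fst has_derivative fst) (at u)" "((\<lambda>u. fst (snd u)) has_derivative (\<lambda>d. fst (snd d))) (at u)"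
     "((\<lambda>u. snd (snd u)) has_derivative (\<lambda>d. snd (snd d))) (at u)"
    by (auto intro!: derivative_eq_intros)
  have P: "((\<lambda>u. pressure \<gamma> (fst u)) has_derivative (\<lambda>d. fst u powr (\<gamma> - 1) * fst d)) (at u)"
    using has_derivative_compose[OF d(1) pressure_has_derivative[OF u, unfolded has_field_derivative_def]]
    by simp
  have h: "((\<lambda>u. snd (snd u) / fst u) has_derivative
     (\<lambda>d. snd (snd d) / fst u - snd (snd u) * fst d / (fst u)\<^sup>2)) (at u)"
    using u by (auto intro!: derivative_eq_intros d simp: field_simps power2_eq_square)
  have z: "((\<lambda>u. fst (snd u) / fst u) has_derivative
     (\<lambda>d. fst (snd d) / fst u - fst (snd u) * fst d / (fst u)\<^sup>2)) (at u)"
    using u by (auto intro!: derivative_eq_intros d simp: field_simps power2_eq_square)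
  have "((\<lambda>u. a (snd (snd u) / fst u)) has_derivative
     (\<lambda>d. da (snd (snd u) / fst u) * (snd (snd d) / fst u - snd (snd u) * fst d / (fst u)\<^sup>2))) (at u)"
    using has_derivative_compose[OF h da(1)[unfolded has_field_derivative_def]] by simp
  from has_derivative_diff[OF z has_derivative_mult[OF this P]] show ?thesis
    unfolding velocity_alt[abs_def] by (rule has_derivative_eq_rhs) (auto simp: dvel_def)
qed

text \<open>In the direction u itself neither \<omega> nor h changes to first order, so only the
  pressure term of \<open>dvel\<close> survives.\<close>

lemma dvel_self:
  assumes "u \<in> phase_space"
  shows "dvel u u = lambda1 \<gamma> a u - velocity \<gamma> a u"
  using assms by (simp add: phase_space_alt lambda1_alt dvel_def power2_eq_square powr_diff)

text \<open>The Jacobian is the velocity times the identity plus a rank-one map with range spanned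
  by u. Its eigenspaces can be read off: the kernel of \<open>dvel u\<close> for the double
  eigenvalue and the line through u for the first one.\<close>

lemma flux_has_derivative:
  assumes "u \<in> phase_space"
  shows "(flux \<gamma> a has_derivative (\<lambda>d. velocity \<gamma> a u *\<^sub>R d + dvel u d *\<^sub>R u)) (at u)"
  unfolding flux_def[abs_def]
  using has_derivative_scaleR[OF velocity_has_derivative[OF assms] has_derivative_ident] by simp

lemma flux_differentiable: "u \<in> phase_space \<Longrightarrow> flux \<gamma> a differentiable (at u)"
  using flux_has_derivative differentiable_def by blast

lemma frechet_derivative_flux:
  assumes "u \<in> phase_space"
  shows "frechet_derivative (flux \<gamma> a) (at u) d = velocity \<gamma> a u *\<^sub>R d + dvel u d *\<^sub>R u"
  using frechet_derivative_at[OF flux_has_derivative[OF assms]] by metis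

text \<open>The rank-one form of the Jacobian gives (\<lambda>1 - v) r = dvel(r) u, and the gap
  \<lambda>1 < v permits division.\<close>

lemma eigenvector_field_lambda1_imp:
  assumes r: "eigenvector_field phase_space (flux \<gamma> a) (lambda1 \<gamma> a) r" and u: "u \<in> phase_space"
  obtains k where "r u = k *\<^sub>R u"
proof
  let ?l = "lambda1 \<gamma> a u - velocity \<gamma> a u"
  have "?l *\<^sub>R r u = dvel u (r u) *\<^sub>R u"
    using r u frechet_derivative_flux[OF u, of "r u"]
    by (auto simp: eigenvector_field_def algebra_simps)
  moreover have "?l \<noteq> 0" using lambda1_less_velocity[OF u] by simp
  ultimately show "r u = (dvel u (r u) / ?l) *\<^sub>R u"
    by (metis (no_types, lifting) divide_inverse_commute scaleR_left_imp_eq right_inverse scaleR_one scaleR_scaleR mult.commute)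
qed

lemma eigenvector_field_lambda2_iff:
  "eigenvector_field phase_space (flux \<gamma> a) (lambda2 \<gamma> a) r \<longleftrightarrow>
     continuous_on phase_space r \<and> (\<forall>u\<in>phase_space. r u \<noteq> 0 \<and> dvel u (r u) = 0)"
proof -
  have "u \<noteq> 0" if "u \<in> phase_space" for u using that by (auto simp: phase_space_alt)
  then show ?thesis
    by (auto simp: eigenvector_field_def lambda2_def frechet_derivative_flux flux_differentiable)
qed

subsection \<open>Rarefaction curves and Hugoniot loci\<close>

lemma scaleR_in_phase_space: "u \<in> phase_space \<Longrightarrow> k *\<^sub>R u \<in> phase_space \<longleftrightarrow> 0 < k"
  by (auto simp: phase_space_alt zero_less_mult_iff)

lemma scaleR_eigenvector_field:
  assumes "k \<noteq> 0"
  shows "eigenvector_field phase_space (flux \<gamma> a) (lambda1 \<gamma> a) (\<lambda>u. k *\<^sub>R u)"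
proof -
  have "frechet_derivative (flux \<gamma> a) (at u) (k *\<^sub>R u) = lambda1 \<gamma> a u *\<^sub>R k *\<^sub>R u"
    if u: "u \<in> phase_space" for u
  proof -
    have "dvel u (k *\<^sub>R u) = k * (lambda1 \<gamma> a u - velocity \<gamma> a u)"
      using has_derivative_linear[OF velocity_has_derivative[OF u]] dvel_self[OF u]
      by (simp add: linear_cmul)
    then show ?thesis
      by (simp add: frechet_derivative_flux[OF u] right_diff_distrib scaleR_diff_left mult.commute)
  qed
  moreover have "u \<noteq> 0" if "u \<in> phase_space" for u using that by (auto simp: phase_space_alt)
  ultimately show ?thesis
    using assms by (auto simp: eigenvector_field_def flux_differentiable intro!: continuous_intros)
qed

lemma rarefaction_curve_lambda1:
  assumes u0: "u0 \<in> phase_space"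
  shows "rarefaction_curve phase_space (flux \<gamma> a) (lambda1 \<gamma> a) u0 = {k *\<^sub>R u0 |k. 0 < k}"
proof (intro equalityI subsetI)
  fix u assume "u \<in> rarefaction_curve phase_space (flux \<gamma> a) (lambda1 \<gamma> a) u0"
  then obtain r T c where r: "eigenvector_field phase_space (flux \<gamma> a) (lambda1 \<gamma> a) r"
    and T: "0 \<le> T" and c: "c 0 = u0" "c T = u"
    and C: "\<And>\<tau>. \<tau> \<in> {0..T} \<Longrightarrow> c \<tau> \<in> phase_space"
      "\<And>\<tau>. \<tau> \<in> {0..T} \<Longrightarrow> (c has_vector_derivative r (c \<tau>)) (at \<tau> within {0..T})"
    unfolding rarefaction_curve_def by auto
  \<comment> \<open>This is (1, \<omega>, h) along the curve, so its constancy says that \<omega>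
    and h are Riemann invariants. The factor k below may vary with \<tau>, which covers every choice
    of the field r.\<close>
  define q where "q \<tau> = inverse (fst (c \<tau>)) *\<^sub>R c \<tau>" for \<tau>
  have "(q has_vector_derivative 0) (at \<tau> within {0..T})" if \<tau>: "\<tau> \<in> {0..T}" for \<tau>
  proof -
    obtain k where k: "r (c \<tau>) = k *\<^sub>R c \<tau>"
      using eigenvector_field_lambda1_imp[OF r C(1)[OF \<tau>]] .
    have pos: "0 < fst (c \<tau>)" using C(1)[OF \<tau>] by (simp add: phase_space_alt)
    note D = C(2)[OF \<tau>, unfolded k has_vector_derivative_def]
    have "(q has_derivative (\<lambda>x. 0)) (at \<tau> within {0..T})"
      unfolding q_def using pos
      by (auto intro!: derivative_eq_intros D has_derivative_fst simp: algebra_simps power2_eq_square)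
    then show ?thesis by (simp add: has_vector_derivative_def)
  qed
  then have "q T = q 0" using T by (rule has_vector_derivative_zero_endpoints)
  then have "inverse (fst u) *\<^sub>R u = inverse (fst u0) *\<^sub>R u0" by (simp add: q_def c)
  then have "fst u *\<^sub>R inverse (fst u) *\<^sub>R u = fst u *\<^sub>R inverse (fst u0) *\<^sub>R u0" by simp
  moreover have pos: "0 < fst u" "0 < fst u0" using C(1)[of T] T u0 c by (auto simp: phase_space_alt)
  ultimately have "u = (fst u / fst u0) *\<^sub>R u0" by (simp add: divide_inverse)
  with pos show "u \<in> {k *\<^sub>R u0 |k. 0 < k}" by (metis (mono_tags, lifting) divide_pos_pos mem_Collect_eq)
next
  fix u assume "u \<in> {k *\<^sub>R u0 |k. 0 < k}"
  then obtain k where k: "0 < k" "u = k *\<^sub>R u0" by auto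
  \<comment> \<open>Integral curves are followed forward only, so densities below that of u0 are
    reached with the reversed field; the running time is then the absolute value of
    \<open>ln k\<close>.\<close>
  define \<sigma> :: real where "\<sigma> = (if 1 \<le> k then 1 else -1)"
  define c where "c \<tau> = exp (\<sigma> * \<tau>) *\<^sub>R u0" for \<tau> :: real
  have "(c has_vector_derivative \<sigma> *\<^sub>R c \<tau>) (at \<tau> within S)" for \<tau> S
    unfolding c_def has_vector_derivative_def
    by (auto intro!: derivative_eq_intros simp: algebra_simps)
  moreover have "0 \<le> \<sigma> * ln k" "c (\<sigma> * ln k) = u"
    using k by (auto simp: \<sigma>_def c_def ln_ge_zero)
  moreover have "eigenvector_field phase_space (flux \<gamma> a) (lambda1 \<gamma> a) (\<lambda>u. \<sigma> *\<^sub>R u)"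
    by (rule scaleR_eigenvector_field) (simp add: \<sigma>_def)
  moreover have "c 0 = u0" "\<And>\<tau>. c \<tau> \<in> phase_space"
    using u0 by (auto simp: c_def scaleR_in_phase_space)
  ultimately show "u \<in> rarefaction_curve phase_space (flux \<gamma> a) (lambda1 \<gamma> a) u0"
    unfolding rarefaction_curve_def by blast
qed

section \<open>Second family: level sets of the velocity\<close>

text \<open>The constant field (p, 0, q) of the coordinates (\<rho>, v, h), written in conserved
  variables. Its integral curves are segments in those coordinates, and it is defined on all of
  \<open>phase_space\<close>.\<close>

definition level_field :: "real \<Rightarrow> real \<Rightarrow> state \<Rightarrow> state" where
  "level_field p q u = (p,
     p * (fst (snd u) / fst u + a (snd (snd u) / fst u) * fst u powr \<gamma>)
       + q * (fst u * da (snd (snd u) / fst u) * pressure \<gamma> (fst u)),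
     p * (snd (snd u) / fst u) + q * fst u)"

lemma dvel_level_field:
  assumes "u \<in> phase_space"
  shows "dvel u (level_field p q u) = 0"
proof -
  obtain \<rho> z w where u: "u = (\<rho>, z, w)" by (cases u) auto
  have \<rho>: "0 < \<rho>" using assms by (simp add: u phase_space_alt)
  have "\<rho> powr (\<gamma> - 1) = \<rho> powr \<gamma> / \<rho>" using \<rho> by (simp add: powr_diff)
  with \<rho> show ?thesis
    by (simp add: u dvel_def level_field_def field_simps power2_eq_square)
qed

lemma level_field_eigenvector:
  assumes "p \<noteq> 0 \<or> q \<noteq> 0"
  shows "eigenvector_field phase_space (flux \<gamma> a) (lambda2 \<gamma> a) (level_field p q)"
  unfolding eigenvector_field_lambda2_iff
proof (intro conjI ballI)
  have P: "continuous_on {0<..} (pressure \<gamma>)"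
    by (auto intro!: continuous_at_imp_continuous_on DERIV_isCont[OF pressure_has_derivative])
  have "continuous_on phase_space (\<lambda>u. pressure \<gamma> (fst u))"
    by (rule continuous_on_compose2[OF P]) (auto intro!: continuous_intros simp: phase_space_alt)
  moreover have h: "continuous_on phase_space (\<lambda>u. snd (snd u) / fst u)"
    by (auto intro!: continuous_intros simp: phase_space_alt)
  moreover have "continuous_on phase_space (\<lambda>u. a (snd (snd u) / fst u))"
    "continuous_on phase_space (\<lambda>u. da (snd (snd u) / fst u))"
    by (rule continuous_on_compose2[OF continuous_on_a[of UNIV] h] continuous_on_compose2[OF da(2) h]; simp)+
  ultimately show "continuous_on phase_space (level_field p q)"
    unfolding level_field_def[abs_def]
    by (intro continuous_intros) (auto simp: phase_space_alt)
next
  fix u assume u: "u \<in> phase_space"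
  then show "level_field p q u \<noteq> 0"
    using assms by (auto simp: level_field_def phase_space_alt zero_prod_def)
  show "dvel u (level_field p q u) = 0" using u by (rule dvel_level_field)
qed

text \<open>In the coordinates \<open>(\<rho>, v, h)\<close> the level sets of the velocity are half planes, in which any two
  states are joined by a segment.\<close>

definition level_curve :: "state \<Rightarrow> state \<Rightarrow> real \<Rightarrow> state" where
  "level_curve u0 u \<tau> = state_of \<gamma> a (fst u0 + \<tau> * (fst u - fst u0)) (velocity \<gamma> a u0)
     (snd (snd u0) / fst u0 + \<tau> * (snd (snd u) / fst u - snd (snd u0) / fst u0))"

lemma level_curve:
  assumes u0: "u0 \<in> phase_space" and u: "u \<in> phase_space" and v: "velocity \<gamma> a u = velocity \<gamma> a u0"
  shows level_curve_0: "level_curve u0 u 0 = u0" and level_curve_1: "level_curve u0 u 1 = u"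
    and level_curve_in: "\<tau> \<in> {0..1} \<Longrightarrow> level_curve u0 u \<tau> \<in> phase_space"
    and velocity_level_curve: "\<tau> \<in> {0..1} \<Longrightarrow> velocity \<gamma> a (level_curve u0 u \<tau>) = velocity \<gamma> a u0"
    and level_curve_neq: "u \<noteq> u0 \<Longrightarrow> \<tau> \<in> {0<..1} \<Longrightarrow> level_curve u0 u \<tau> \<noteq> u0"
    and level_curve_deriv: "\<tau> \<in> {0..1} \<Longrightarrow> (level_curve u0 u has_vector_derivative
      level_field (fst u - fst u0) (snd (snd u) / fst u - snd (snd u0) / fst u0)
        (level_curve u0 u \<tau>)) (at \<tau> within S)"
proof -
  let ?\<rho> = "\<lambda>\<tau>. fst u0 + \<tau> * (fst u - fst u0)" and ?v = "velocity \<gamma> a u0"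
    and ?h = "\<lambda>\<tau>. snd (snd u0) / fst u0 + \<tau> * (snd (snd u) / fst u - snd (snd u0) / fst u0)"
  have pos: "0 < fst u0" "0 < fst u" using u0 u by (auto simp: phase_space_alt)
  show "level_curve u0 u 0 = u0" by (simp add: level_curve_def flip: eq_state_of[OF u0])
  show "level_curve u0 u 1 = u" using eq_state_of[OF u, of \<gamma> a] by (simp add: level_curve_def v)
  have \<rho>: "0 < ?\<rho> \<tau>" if "\<tau> \<in> {0..1}" for \<tau>
  proof -
    have "?\<rho> \<tau> = (1 - \<tau>) * fst u0 + \<tau> * fst u" by (simp add: algebra_simps)
    moreover have "0 < (1 - \<tau>) * fst u0 + \<tau> * fst u"
    proof (cases "\<tau> = 0")
      case False
      then have "0 < \<tau> * fst u" "0 \<le> (1 - \<tau>) * fst u0" using that pos by auto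
      then show ?thesis by linarith
    qed (use pos in simp)
    ultimately show ?thesis by simp
  qed
  show "level_curve u0 u \<tau> \<in> phase_space" if "\<tau> \<in> {0..1}"
    using \<rho>[OF that] by (simp add: level_curve_def state_of_eq_ray ray_in_phase_space)
  show "velocity \<gamma> a (level_curve u0 u \<tau>) = ?v" if "\<tau> \<in> {0..1}"
    unfolding level_curve_def using \<rho>[OF that] by (rule velocity_state_of)
  \<comment> \<open>A Hugoniot curve has to leave its base state for good. A return at \<tau> > 0
    would force equal density and equal h at the two end states, hence u = u0.\<close>
  show "level_curve u0 u \<tau> \<noteq> u0" if "u \<noteq> u0" "\<tau> \<in> {0<..1}"
  proof
    assume eq: "level_curve u0 u \<tau> = u0"
    from arg_cong[OF eq, of fst] that(2) have 2: "fst u = fst u0"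
      by (simp add: level_curve_def state_of_def)
    from arg_cong[OF eq, of "\<lambda>u. snd (snd u)"] that(2) pos have 3: "snd (snd u) / fst u = snd (snd u0) / fst u0"
      by (simp add: level_curve_def state_of_def 2 field_simps)
    have "u = u0" using eq_state_of[OF u, of \<gamma> a] eq_state_of[OF u0, of \<gamma> a] v 2 3 by metis
    with that(1) show False by simp
  qed
  show "(level_curve u0 u has_vector_derivative
      level_field (fst u - fst u0) (snd (snd u) / fst u - snd (snd u0) / fst u0)
        (level_curve u0 u \<tau>)) (at \<tau> within S)" if \<tau>: "\<tau> \<in> {0..1}"
  proof -
    define p q where "p = fst u - fst u0" "q = snd (snd u) / fst u - snd (snd u0) / fst u0"
    define R where "R t = fst u0 + t * p" for t
    define H where "H t = snd (snd u0) / fst u0 + t * q" for t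
    have R0: "0 < R \<tau>" using \<rho>[OF \<tau>] by (simp add: R_def p_q_def)
    have d: "(R has_field_derivative p) (at \<tau> within S)" "(H has_field_derivative q) (at \<tau> within S)"
      unfolding R_def[abs_def] H_def[abs_def] by (auto intro!: derivative_eq_intros)
    have P: "((\<lambda>t. pressure \<gamma> (R t)) has_field_derivative R \<tau> powr (\<gamma> - 1) * p) (at \<tau> within S)"
      by (rule DERIV_chain2[OF pressure_has_derivative[OF R0] d(1)])
    have A: "((\<lambda>t. a (H t)) has_field_derivative da (H \<tau>) * q) (at \<tau> within S)"
      by (rule DERIV_chain2[OF da(1) d(2)])
    have z: "((\<lambda>t. R t * (?v + a (H t) * pressure \<gamma> (R t))) has_field_derivative
        p * (?v + a (H \<tau>) * pressure \<gamma> (R \<tau>))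
        + (0 + (da (H \<tau>) * q * pressure \<gamma> (R \<tau>) + R \<tau> powr (\<gamma> - 1) * p * a (H \<tau>))) * R \<tau>)
        (at \<tau> within S)"
      by (intro derivative_intros DERIV_mult d P A)
    have w: "((\<lambda>t. R t * H t) has_field_derivative p * H \<tau> + q * R \<tau>) (at \<tau> within S)"
      by (intro DERIV_mult d)
    have c: "level_curve u0 u = (\<lambda>t. (R t, R t * (?v + a (H t) * pressure \<gamma> (R t)), R t * H t))"
      by (simp add: fun_eq_iff level_curve_def state_of_def R_def H_def p_q_def)
    have "R \<tau> powr \<gamma> = R \<tau> powr (\<gamma> - 1) * R \<tau>" using R0 by (simp add: powr_diff)
    then have f: "level_field p q (level_curve u0 u \<tau>) =
       (p, p * (?v + a (H \<tau>) * pressure \<gamma> (R \<tau>))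
        + (0 + (da (H \<tau>) * q * pressure \<gamma> (R \<tau>) + R \<tau> powr (\<gamma> - 1) * p * a (H \<tau>))) * R \<tau>,
        p * H \<tau> + q * R \<tau>)"
      using R0 by (simp add: c level_field_def) (simp add: algebra_simps)
    show ?thesis
      unfolding p_q_def[symmetric] f unfolding c using d(1) z w
      by (intro has_vector_derivative_Pair) (auto simp: has_real_derivative_iff_has_vector_derivative)
  qed
qed

text \<open>The speed of this family is the velocity, a first integral of each of its fields.
  Conversely the field may depend on the target: each state of the level set gets a constant field
  aimed at it.\<close>

lemma rarefaction_curve_lambda2:
  assumes u0: "u0 \<in> phase_space"
  shows "rarefaction_curve phase_space (flux \<gamma> a) (lambda2 \<gamma> a) u0
     = {u \<in> phase_space. velocity \<gamma> a u = velocity \<gamma> a u0}"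
proof (intro equalityI subsetI)
  fix u assume "u \<in> rarefaction_curve phase_space (flux \<gamma> a) (lambda2 \<gamma> a) u0"
  then obtain r T c where r: "eigenvector_field phase_space (flux \<gamma> a) (lambda2 \<gamma> a) r"
    and T: "0 \<le> T" and c: "c 0 = u0" "c T = u"
    and C: "\<And>\<tau>. \<tau> \<in> {0..T} \<Longrightarrow> c \<tau> \<in> phase_space"
      "\<And>\<tau>. \<tau> \<in> {0..T} \<Longrightarrow> (c has_vector_derivative r (c \<tau>)) (at \<tau> within {0..T})"
    unfolding rarefaction_curve_def by auto
  have "((\<lambda>\<tau>. velocity \<gamma> a (c \<tau>)) has_vector_derivative 0) (at \<tau> within {0..T})"
    if \<tau>: "\<tau> \<in> {0..T}" for \<tau>
  proof -
    have "dvel (c \<tau>) (r (c \<tau>)) = 0"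
      using r C(1)[OF \<tau>] by (simp add: eigenvector_field_lambda2_iff)
    then have "dvel (c \<tau>) (x *\<^sub>R r (c \<tau>)) = 0" for x
      using has_derivative_linear[OF velocity_has_derivative[OF C(1)[OF \<tau>]]] by (simp add: linear_cmul)
    then show ?thesis
      using has_derivative_compose[OF C(2)[OF \<tau>, unfolded has_vector_derivative_def]
          velocity_has_derivative[OF C(1)[OF \<tau>]]]
      by (simp add: has_vector_derivative_def)
  qed
  then have "velocity \<gamma> a (c T) = velocity \<gamma> a (c 0)"
    using T by (rule has_vector_derivative_zero_endpoints)
  then show "u \<in> {u \<in> phase_space. velocity \<gamma> a u = velocity \<gamma> a u0}"
    using C(1)[of T] T c by simp
next
  fix u assume "u \<in> {u \<in> phase_space. velocity \<gamma> a u = velocity \<gamma> a u0}"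
  then have u: "u \<in> phase_space" "velocity \<gamma> a u = velocity \<gamma> a u0" by auto
  show "u \<in> rarefaction_curve phase_space (flux \<gamma> a) (lambda2 \<gamma> a) u0"
  proof (cases "u = u0")
    case True
    \<comment> \<open>With T = 0 the time domain is one point, where any vector is a derivative;
      \<open>level_field 1 0\<close> just supplies some eigenvector field.\<close>
    have "((\<lambda>\<tau>. u0) has_vector_derivative r) (at 0 within {0..0})" for r
      by (simp add: has_vector_derivative_def has_derivative_within_singleton_iff bounded_linear_scaleR_left)
    then show ?thesis
      using level_field_eigenvector[of 1 0] u0 True unfolding rarefaction_curve_def
      by (intro CollectI exI[of _ "level_field 1 0"] exI[of _ 0] exI[of _ "\<lambda>_. u0"]) auto
  next
    case False
    let ?p = "fst u - fst u0" and ?q = "snd (snd u) / fst u - snd (snd u0) / fst u0"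
    have "?p \<noteq> 0 \<or> ?q \<noteq> 0"
      using False eq_state_of[OF u(1), of \<gamma> a] eq_state_of[OF u0, of \<gamma> a] u(2) by auto
    from level_field_eigenvector[OF this] show ?thesis
      unfolding rarefaction_curve_def
      by (intro CollectI exI[of _ "level_field ?p ?q"] exI[of _ 1] exI[of _ "level_curve u0 u"])
        (use level_curve[OF u0 u] in auto)
  qed
qed

section \<open>Solutions of the jump condition and the two Hugoniot branches\<close>

text \<open>With v0 and v the velocities of u0 and u, the condition rearranges to (s - v0) u0 = (s -
  v) u. Either both coefficients vanish, or the two states are parallel.\<close>

lemma rankine_hugoniot_cases:
  assumes u0: "u0 \<in> phase_space" and u: "u \<in> phase_space"
    and rh: "rankine_hugoniot (flux \<gamma> a) u0 u s"
  obtains "s = velocity \<gamma> a u0" "velocity \<gamma> a u = velocity \<gamma> a u0"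
  | "u = (fst u / fst u0) *\<^sub>R u0"
proof (cases "s = velocity \<gamma> a u0")
  case True
  have "(velocity \<gamma> a u - velocity \<gamma> a u0) *\<^sub>R u = 0"
    using rh True by (simp add: rankine_hugoniot_def flux_def algebra_simps)
  moreover have "u \<noteq> 0" using u by (auto simp: phase_space_alt)
  ultimately show ?thesis using True that(1) by simp
next
  case False
  let ?x = "s - velocity \<gamma> a u0" and ?y = "s - velocity \<gamma> a u"
  have eq: "?x *\<^sub>R u0 = ?y *\<^sub>R u"
    using rh by (simp add: rankine_hugoniot_def flux_def algebra_simps)
  have "fst (?x *\<^sub>R u0) = fst (?y *\<^sub>R u)" unfolding eq ..
  then have f: "?x * fst u0 = ?y * fst u" by simp
  have pos: "0 < fst u0" "0 < fst u" using u0 u by (auto simp: phase_space_alt)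
  with f False have y: "?y \<noteq> 0" by auto
  have x: "?x = ?y * (fst u / fst u0)" using f pos by (simp add: field_simps)
  have "?y *\<^sub>R u = ?y *\<^sub>R ((fst u / fst u0) *\<^sub>R u0)"
    unfolding scaleR_scaleR x[symmetric] eq ..
  with y have "u = (fst u / fst u0) *\<^sub>R u0" by (metis scaleR_left_imp_eq)
  then show ?thesis by (rule that(2))
qed

text \<open>The jump condition gives (s - v0) (\<rho> - \<rho>') = \<rho>' (v0 - v'), where the
  velocity decreases with density. This strict gap is what keeps the two branches of the Hugoniot
  set apart.\<close>

lemma ray_secant_less_velocity:
  assumes pos: "0 < \<rho>" "0 < \<rho>'" and ne: "\<rho> \<noteq> \<rho>'"
    and s: "ray_flux \<gamma> a \<omega> h \<rho> - ray_flux \<gamma> a \<omega> h \<rho>' = s * (\<rho> - \<rho>')"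
  shows "s < \<omega> - a h * pressure \<gamma> \<rho>"
proof -
  have eq: "(s - (\<omega> - a h * pressure \<gamma> \<rho>)) * (\<rho> - \<rho>') = \<rho>' * (a h * (pressure \<gamma> \<rho>' - pressure \<gamma> \<rho>))"
    using s unfolding ray_flux_def by (simp add: algebra_simps)
  show ?thesis
  proof (cases "\<rho> < \<rho>'")
    case True
    then have "0 < \<rho>' * (a h * (pressure \<gamma> \<rho>' - pressure \<gamma> \<rho>))"
      using pos a_pos pressure_strict_mono[OF gamma] by simp
    with True show ?thesis unfolding eq[symmetric] by (simp add: zero_less_mult_iff)
  next
    case False
    then have "0 < \<rho>' * (a h * (pressure \<gamma> \<rho> - pressure \<gamma> \<rho>'))"
      using pos ne a_pos pressure_strict_mono[OF gamma, of \<rho>' \<rho>] by simp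
    then have "\<rho>' * (a h * (pressure \<gamma> \<rho>' - pressure \<gamma> \<rho>)) < 0"
      by (simp add: algebra_simps)
    with False show ?thesis unfolding eq[symmetric] by (simp add: mult_less_0_iff)
  qed
qed

text \<open>Off the base point, \<open>s\<close> equals the base velocity on the velocity level set and is smaller on
  the ray. Hence a connected Hugoniot curve stays on one of the two, and the initial speed tells
  on which.\<close>

lemma hugoniot_curve_cases:
  fixes c :: "real \<Rightarrow> state" and s :: "real \<Rightarrow> real"
  assumes u0: "u0 \<in> phase_space" and c: "continuous_on {0..1} c" "c 0 = u0"
    and s: "continuous_on {0..1} s"
    and rh: "\<And>\<tau>. \<tau> \<in> {0<..1} \<Longrightarrow>
      c \<tau> \<in> phase_space \<and> c \<tau> \<noteq> u0 \<and> rankine_hugoniot (flux \<gamma> a) u0 (c \<tau>) (s \<tau>)"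
  obtains "s 0 = lambda1 \<gamma> a u0" "c 1 = (fst (c 1) / fst u0) *\<^sub>R u0"
  | "s 0 = lambda2 \<gamma> a u0" "velocity \<gamma> a (c 1) = velocity \<gamma> a u0"
proof -
  define \<omega> h \<rho>0 where "\<omega> = fst (snd u0) / fst u0" "h = snd (snd u0) / fst u0" "\<rho>0 = fst u0"
  have u0_ray: "u0 = ray \<omega> h \<rho>0" using eq_ray[OF u0] by (simp add: \<omega>_h_\<rho>0_def)
  have \<rho>0: "0 < \<rho>0" using u0 by (simp add: \<omega>_h_\<rho>0_def phase_space_alt)
  obtain g where g: "g \<rho>0 = ray_speed \<gamma> a \<omega> h \<rho>0" "continuous_on {0<..} g"
    "\<And>\<rho>. ray_flux \<gamma> a \<omega> h \<rho>0 - ray_flux \<gamma> a \<omega> h \<rho> = g \<rho> * (\<rho>0 - \<rho>)"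
    using ray_secant[OF \<rho>0] by blast
  let ?v0 = "velocity \<gamma> a u0"
  \<comment> \<open>A says that the state is on the ray, in a form without division; B bounds the
    speed from below by an inequality. Both sets are thus closed in the whole line, and they can
    meet only at \<tau> = 0, so connectedness is used on the interval without 0.\<close>
  define A where "A = {\<tau> \<in> {0..1}. \<rho>0 *\<^sub>R c \<tau> = fst (c \<tau>) *\<^sub>R u0}"
  define B where "B = {\<tau> \<in> {0..1}. ?v0 \<le> s \<tau>}"
  have A: "c \<tau> = (fst (c \<tau>) / fst u0) *\<^sub>R u0" if "\<tau> \<in> A" for \<tau>
  proof -
    have "inverse \<rho>0 *\<^sub>R \<rho>0 *\<^sub>R c \<tau> = inverse \<rho>0 *\<^sub>R fst (c \<tau>) *\<^sub>R u0" using that by (simp add: A_def)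
    then show ?thesis using \<rho>0 by (simp add: \<omega>_h_\<rho>0_def(3) divide_inverse mult.commute)
  qed
  have on_ray: "s \<tau> = g (fst (c \<tau>)) \<and> s \<tau> < ?v0" if "\<tau> \<in> A" "\<tau> \<in> {0<..1}" for \<tau>
  proof -
    define \<rho> where "\<rho> = fst (c \<tau>)"
    have \<rho>: "0 < \<rho>" using rh[OF that(2)] by (simp add: \<rho>_def phase_space_alt)
    have "c \<tau> = (\<rho> / \<rho>0) *\<^sub>R u0" using A[OF that(1)] by (simp add: \<rho>_def \<omega>_h_\<rho>0_def(3))
    then have c_ray: "c \<tau> = ray \<omega> h \<rho>" using \<rho>0 by (simp add: u0_ray ray_def)
    then have ne: "\<rho>0 \<noteq> \<rho>" using rh[OF that(2)] u0_ray by auto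
    have "ray_flux \<gamma> a \<omega> h \<rho>0 - ray_flux \<gamma> a \<omega> h \<rho> = s \<tau> * (\<rho>0 - \<rho>)"
      using rh[OF that(2)] rankine_hugoniot_ray[OF \<rho>0 \<rho>] by (simp add: u0_ray c_ray)
    moreover from this have "g \<rho> * (\<rho>0 - \<rho>) = s \<tau> * (\<rho>0 - \<rho>)" using g(3)[of \<rho>] by simp
    then have "s \<tau> = g \<rho>" using ne by simp
    ultimately show ?thesis
      using ray_secant_less_velocity[OF \<rho>0 \<rho> ne] ne
      by (simp add: u0_ray velocity_ray[OF \<rho>0] \<rho>_def)
  qed
  have "A = {\<tau> \<in> {0..1}. \<rho>0 *\<^sub>R c \<tau> - fst (c \<tau>) *\<^sub>R u0 = 0}" by (simp add: A_def)
  then have "closed A"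
    by (simp only:) (intro continuous_closed_preimage_constant continuous_intros c closed_atLeastAtMost)
  moreover have "closed B"
    unfolding B_def by (intro continuous_on_closed_Collect_le continuous_intros s closed_atLeastAtMost)
  moreover have "{0<..1} \<subseteq> A \<union> B"
  proof
    fix \<tau> :: real assume \<tau>: "\<tau> \<in> {0<..1}"
    show "\<tau> \<in> A \<union> B"
    proof (rule rankine_hugoniot_cases[OF u0, of "c \<tau>" "s \<tau>"])
      assume "c \<tau> = (fst (c \<tau>) / fst u0) *\<^sub>R u0"
      then have "\<rho>0 *\<^sub>R c \<tau> = \<rho>0 *\<^sub>R ((fst (c \<tau>) / fst u0) *\<^sub>R u0)" by simp
      then have "\<tau> \<in> A" using \<tau> \<rho>0 by (simp add: A_def \<omega>_h_\<rho>0_def(3))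
      then show ?thesis ..
    qed (use rh[OF \<tau>] \<tau> in \<open>auto simp: B_def\<close>)
  qed
  moreover have "A \<inter> B \<inter> {0<..1} = {}" using on_ray by (force simp: B_def)
  ultimately have "A \<inter> {0<..1} = {} \<or> B \<inter> {0<..1} = {}"
    using connected_Ioc[of 0 "1::real"] unfolding connected_closed by blast
  then consider "A \<inter> {0<..1} = {}" | "B \<inter> {0<..1} = {}" by blast
  note dichotomy = this
  have nontriv: "at 0 within {0<..1::real} \<noteq> bot"
  proof -
    have "{0<..1::real} - {0} = {0..1} - {0}" by auto
    then have "at 0 within {0<..1::real} = at 0 within {0..1}" by (simp add: at_within_def)
    then show ?thesis by (simp add: at_within_Icc_at_right)
  qed
  \<comment> \<open>At the base state the jump condition says nothing about the speed, so
    \<open>s 0\<close> is recovered as a limit from \<tau> > 0.\<close>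
  have "(s \<longlongrightarrow> s 0) (at 0 within {0..1})" using s by (simp add: continuous_on_def)
  then have s0: "(s \<longlongrightarrow> s 0) (at 0 within {0<..1::real})"
    by (rule tendsto_within_subset) auto
  from dichotomy show thesis
  proof cases
    case 1
    have v: "s \<tau> = ?v0 \<and> velocity \<gamma> a (c \<tau>) = ?v0" if \<tau>: "\<tau> \<in> {0<..1}" for \<tau>
    proof (rule rankine_hugoniot_cases[OF u0, of "c \<tau>" "s \<tau>"])
      assume "c \<tau> = (fst (c \<tau>) / fst u0) *\<^sub>R u0"
      then have "\<rho>0 *\<^sub>R c \<tau> = \<rho>0 *\<^sub>R ((fst (c \<tau>) / fst u0) *\<^sub>R u0)" by simp
      then have "\<tau> \<in> A" using \<tau> \<rho>0 by (simp add: A_def \<omega>_h_\<rho>0_def(3))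
      then show ?thesis using 1 \<tau> by blast
    qed (use rh[OF \<tau>] in auto)
    have "((\<lambda>_. ?v0) \<longlongrightarrow> s 0) (at 0 within {0<..1::real})"
      by (rule Lim_transform_eventually[OF s0]) (auto simp: eventually_at_filter v)
    from tendsto_unique[OF nontriv this tendsto_const] have "s 0 = ?v0" .
    then show thesis using that(2) v[of 1] by (simp add: lambda2_def)
  next
    case 2
    then have all: "\<tau> \<in> A" if "\<tau> \<in> {0<..1}" for \<tau> using that \<open>{0<..1} \<subseteq> A \<union> B\<close> by blast
    have "continuous_on {0..1} (\<lambda>\<tau>. g (fst (c \<tau>)))"
    proof (rule continuous_on_compose2[OF g(2)])
      show "(\<lambda>\<tau>. fst (c \<tau>)) ` {0..1} \<subseteq> {0<..}"
      proof clarsimp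
        fix \<tau> :: real assume "0 \<le> \<tau>" "\<tau> \<le> 1"
        then show "0 < fst (c \<tau>)"
          using rh[of \<tau>] c(2) u0 by (cases "\<tau> = 0") (auto simp: phase_space_alt)
      qed
    qed (intro continuous_intros c(1))
    then have "((\<lambda>\<tau>. g (fst (c \<tau>))) \<longlongrightarrow> g \<rho>0) (at 0 within {0..1})"
      using c(2) by (auto simp: continuous_on_def \<omega>_h_\<rho>0_def(3))
    then have gl: "((\<lambda>\<tau>. g (fst (c \<tau>))) \<longlongrightarrow> g \<rho>0) (at 0 within {0<..1::real})"
      by (rule tendsto_within_subset) auto
    have "(s \<longlongrightarrow> g \<rho>0) (at 0 within {0<..1::real})"
      by (rule Lim_transform_eventually[OF gl]) (auto simp: eventually_at_filter on_ray all)
    from tendsto_unique[OF nontriv s0 this] have "s 0 = g \<rho>0" .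
    then have "s 0 = lambda1 \<gamma> a u0" by (simp add: g(1) u0_ray lambda1_ray[OF \<rho>0])
    then show thesis using that(1) A[OF all[of 1]] by simp
  qed
qed

text \<open>A curve starting with speed \<lambda>1 cannot be on the velocity level set, as
  \<lambda>1 < v at u0. Conversely, moving the density affinely from u0 to u with the secant slope
  as speed gives a Hugoniot curve.\<close>

lemma hugoniot_locus_lambda1:
  assumes u0: "u0 \<in> phase_space"
  shows "hugoniot_locus phase_space (flux \<gamma> a) (lambda1 \<gamma> a) u0 = {k *\<^sub>R u0 |k. 0 < k}"
proof (intro equalityI subsetI)
  fix u assume "u \<in> hugoniot_locus phase_space (flux \<gamma> a) (lambda1 \<gamma> a) u0"
  then show "u \<in> {k *\<^sub>R u0 |k. 0 < k}"
  proof (cases rule: hugoniot_locusE)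
    case 1
    then have "u = 1 *\<^sub>R u0 \<and> (0::real) < 1" by simp
    then show ?thesis by blast
  next
    case (2 c s)
    have "0 < fst u / fst u0" using 2(6)[of 1] 2(4) u0 by (simp add: phase_space_alt)
    moreover have "u = (fst u / fst u0) *\<^sub>R u0"
      by (rule hugoniot_curve_cases[OF u0 2(1,3,2,6)])
        (use 2(4,5) lambda1_less_velocity[OF u0] in \<open>auto simp: lambda2_def\<close>)
    ultimately show ?thesis by blast
  qed
next
  fix u assume "u \<in> {k *\<^sub>R u0 |k. 0 < k}"
  then obtain k where k: "0 < k" "u = k *\<^sub>R u0" by auto
  define \<omega> h \<rho>0 where "\<omega> = fst (snd u0) / fst u0" "h = snd (snd u0) / fst u0" "\<rho>0 = fst u0"
  have u0_ray: "u0 = ray \<omega> h \<rho>0" using eq_ray[OF u0] by (simp add: \<omega>_h_\<rho>0_def)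
  have \<rho>0: "0 < \<rho>0" using u0 by (simp add: \<omega>_h_\<rho>0_def phase_space_alt)
  obtain g where g: "g \<rho>0 = ray_speed \<gamma> a \<omega> h \<rho>0" "continuous_on {0<..} g"
    "\<And>\<rho>. ray_flux \<gamma> a \<omega> h \<rho>0 - ray_flux \<gamma> a \<omega> h \<rho> = g \<rho> * (\<rho>0 - \<rho>)"
    using ray_secant[OF \<rho>0] by blast
  show "u \<in> hugoniot_locus phase_space (flux \<gamma> a) (lambda1 \<gamma> a) u0"
  proof (cases "k = 1")
    case True
    then show ?thesis using k by (simp add: hugoniot_locus_def)
  next
    case False
    define \<rho> where "\<rho> \<tau> = \<rho>0 * (1 + \<tau> * (k - 1))" for \<tau> :: real
    have \<rho>: "0 < \<rho> \<tau>" if "\<tau> \<in> {0..1}" for \<tau>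
    proof -
      have "1 + \<tau> * (k - 1) = (1 - \<tau>) + \<tau> * k" by (simp add: algebra_simps)
      also have "0 < \<dots>" using that k by (cases "\<tau> = 1") (auto intro: add_pos_nonneg)
      finally show ?thesis using \<rho>0 by (simp add: \<rho>_def)
    qed
    have \<rho>c: "continuous_on {0..1} \<rho>" unfolding \<rho>_def by (intro continuous_intros)
    have "continuous_on {0..1} (\<lambda>\<tau>. ray \<omega> h (\<rho> \<tau>))"
      unfolding ray_def by (intro continuous_intros \<rho>c)
    moreover have "continuous_on {0..1} (\<lambda>\<tau>. g (\<rho> \<tau>))"
      using \<rho> by (intro continuous_on_compose2[OF g(2) \<rho>c]) auto
    moreover have "ray \<omega> h (\<rho> 0) = u0" "ray \<omega> h (\<rho> 1) = u" "g (\<rho> 0) = lambda1 \<gamma> a u0"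
      using k by (simp_all add: \<rho>_def u0_ray g(1) lambda1_ray[OF \<rho>0]) (simp add: ray_def algebra_simps)
    moreover have "ray \<omega> h (\<rho> \<tau>) \<in> phase_space \<and> ray \<omega> h (\<rho> \<tau>) \<noteq> u0 \<and>
        rankine_hugoniot (flux \<gamma> a) u0 (ray \<omega> h (\<rho> \<tau>)) (g (\<rho> \<tau>))" if "\<tau> \<in> {0<..1}" for \<tau>
    proof -
      have "0 < \<rho> \<tau>" using \<rho> that by simp
      moreover have "\<rho> \<tau> \<noteq> \<rho>0" using that False \<rho>0 by (simp add: \<rho>_def)
      then have "ray \<omega> h (\<rho> \<tau>) \<noteq> u0" by (simp add: u0_ray ray_def)
      ultimately show ?thesis
        using g(3) by (simp add: ray_in_phase_space) (simp add: u0_ray rankine_hugoniot_ray[OF \<rho>0])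
    qed
    ultimately show ?thesis
      unfolding hugoniot_locus_def
      by (intro UnI2 CollectI exI[of _ "\<lambda>\<tau>. ray \<omega> h (\<rho> \<tau>)"] exI[of _ "\<lambda>\<tau>. g (\<rho> \<tau>)"] conjI ballI)
        auto
  qed
qed

lemma hugoniot_locus_lambda2:
  assumes u0: "u0 \<in> phase_space"
  shows "hugoniot_locus phase_space (flux \<gamma> a) (lambda2 \<gamma> a) u0
     = {u \<in> phase_space. velocity \<gamma> a u = velocity \<gamma> a u0}"
proof (intro equalityI subsetI)
  fix u assume "u \<in> hugoniot_locus phase_space (flux \<gamma> a) (lambda2 \<gamma> a) u0"
  then show "u \<in> {u \<in> phase_space. velocity \<gamma> a u = velocity \<gamma> a u0}"
  proof (cases rule: hugoniot_locusE)
    case 1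
    then show ?thesis using u0 by simp
  next
    case (2 c s)
    have "velocity \<gamma> a u = velocity \<gamma> a u0"
      by (rule hugoniot_curve_cases[OF u0 2(1,3,2,6)])
        (use 2(4,5) lambda1_less_velocity[OF u0] in \<open>auto simp: lambda2_def\<close>)
    then show ?thesis using 2(6)[of 1] 2(4) by simp
  qed
next
  fix u assume "u \<in> {u \<in> phase_space. velocity \<gamma> a u = velocity \<gamma> a u0}"
  then have u: "u \<in> phase_space" "velocity \<gamma> a u = velocity \<gamma> a u0" by auto
  note lc = level_curve[OF u0 u]
  show "u \<in> hugoniot_locus phase_space (flux \<gamma> a) (lambda2 \<gamma> a) u0"
  proof (cases "u = u0")
    case False
    have "continuous_on {0..1} (level_curve u0 u)"
      using lc(6) by (intro continuous_on_vector_derivative) auto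
    moreover have "level_curve u0 u \<tau> \<in> phase_space \<and> level_curve u0 u \<tau> \<noteq> u0 \<and>
        rankine_hugoniot (flux \<gamma> a) u0 (level_curve u0 u \<tau>) (velocity \<gamma> a u0)"
      if "\<tau> \<in> {0<..1}" for \<tau>
      using lc(3,4)[of \<tau>] lc(5)[OF False that] that
      by (simp add: rankine_hugoniot_def flux_def scaleR_diff_right)
    ultimately show ?thesis
      unfolding hugoniot_locus_def using lc(1,2)
      by (intro UnI2 CollectI exI[of _ "level_curve u0 u"] exI[of _ "\<lambda>_. velocity \<gamma> a u0"] conjI ballI)
        (auto simp: lambda2_def)
  qed (simp add: hugoniot_locus_def)
qed

lemma temple_class: "temple_class phase_space (flux \<gamma> a) {lambda1 \<gamma> a, lambda2 \<gamma> a}"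
  unfolding temple_class_def
  by (auto simp: hugoniot_locus_lambda1 hugoniot_locus_lambda2
      rarefaction_curve_lambda1 rarefaction_curve_lambda2)

section \<open>Entropy pairs along the curves of both families\<close>

text \<open>The second family is linearly degenerate, so every entropy satisfies the jump condition
  exactly across a contact discontinuity.\<close>

lemma entropy_contact:
  assumes pair: "convex_entropy_pair phase_space (flux \<gamma> a) \<eta> q"
    and u0: "u0 \<in> phase_space" and u: "u \<in> phase_space" "velocity \<gamma> a u = velocity \<gamma> a u0"
  shows "q u - q u0 = velocity \<gamma> a u0 * (\<eta> u - \<eta> u0)"
proof -
  obtain g where g: "\<And>u. u \<in> phase_space \<Longrightarrow> (\<eta> has_derivative (\<lambda>k. g u \<bullet> k)) (at u)"
    "\<And>u. u \<in> phase_space \<Longrightarrow> (q has_derivative (\<lambda>k. g u \<bullet> frechet_derivative (flux \<gamma> a) (at u) k)) (at u)"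
    using pair unfolding convex_entropy_pair_def by blast
  note lc = level_curve[OF u0 u]
  let ?c = "level_curve u0 u" and ?v = "velocity \<gamma> a u0"
  \<comment> \<open>The tangent of the level curve is an eigenvector whose eigenvalue, the velocity,
    is the same along the whole curve; so q' = v \<eta>' with a constant factor.\<close>
  have "((\<lambda>\<tau>. q (?c \<tau>) - ?v * \<eta> (?c \<tau>)) has_vector_derivative 0) (at \<tau> within {0..1})"
    if \<tau>: "\<tau> \<in> {0..1}" for \<tau>
  proof -
    define d where "d = level_field (fst u - fst u0) (snd (snd u) / fst u - snd (snd u0) / fst u0) (?c \<tau>)"
    have C: "?c \<tau> \<in> phase_space" by (rule lc(3)[OF \<tau>])
    have D: "(?c has_derivative (\<lambda>x. x *\<^sub>R d)) (at \<tau> within {0..1})"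
      using lc(6)[OF \<tau>] by (simp add: d_def has_vector_derivative_def)
    have "dvel (?c \<tau>) d = 0" unfolding d_def by (rule dvel_level_field[OF C])
    then have "dvel (?c \<tau>) (x *\<^sub>R d) = 0" for x
      using has_derivative_linear[OF velocity_has_derivative[OF C]] by (simp add: linear_cmul)
    then have F: "frechet_derivative (flux \<gamma> a) (at (?c \<tau>)) (x *\<^sub>R d) = ?v *\<^sub>R x *\<^sub>R d" for x
      by (simp add: frechet_derivative_flux[OF C] lc(4)[OF \<tau>])
    have "((\<lambda>\<tau>. q (?c \<tau>) - ?v * \<eta> (?c \<tau>)) has_derivative
        (\<lambda>x. g (?c \<tau>) \<bullet> frechet_derivative (flux \<gamma> a) (at (?c \<tau>)) (x *\<^sub>R d)
           - ?v * (g (?c \<tau>) \<bullet> (x *\<^sub>R d)))) (at \<tau> within {0..1})"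
      by (intro has_derivative_diff has_derivative_mult_right
          has_derivative_compose[OF D g(1)[OF C]] has_derivative_compose[OF D g(2)[OF C]])
    then show ?thesis by (simp add: F has_vector_derivative_def)
  qed
  from has_vector_derivative_zero_endpoints[OF this]
  have "q (?c 1) - ?v * \<eta> (?c 1) = q (?c 0) - ?v * \<eta> (?c 0)" by simp
  then show ?thesis using lc(1,2) by (simp add: algebra_simps)
qed

text \<open>The direction of a ray is an eigenvector, which gives the formula for q'. The function d
  is monotone because a ray is straight in the conserved variables and \<eta> is convex there; its
  continuity is needed to integrate over the fan.\<close>

lemma entropy_ray:
  assumes pair: "convex_entropy_pair phase_space (flux \<gamma> a) \<eta> q"
  obtains d where "continuous_on {0<..} d"
    "\<And>\<rho> \<rho>'. 0 < \<rho> \<Longrightarrow> \<rho> \<le> \<rho>' \<Longrightarrow> d \<rho> \<le> d \<rho>'"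
    "\<And>\<rho>. 0 < \<rho> \<Longrightarrow> ((\<lambda>\<rho>. \<eta> (ray \<omega> h \<rho>)) has_field_derivative d \<rho>) (at \<rho>)"
    "\<And>\<rho>. 0 < \<rho> \<Longrightarrow> ((\<lambda>\<rho>. q (ray \<omega> h \<rho>)) has_field_derivative ray_speed \<gamma> a \<omega> h \<rho> * d \<rho>) (at \<rho>)"
proof -
  obtain g where gc: "continuous_on phase_space g" and conv: "convex_on phase_space \<eta>"
    and g: "\<And>u. u \<in> phase_space \<Longrightarrow> (\<eta> has_derivative (\<lambda>k. g u \<bullet> k)) (at u)"
    "\<And>u. u \<in> phase_space \<Longrightarrow> (q has_derivative (\<lambda>k. g u \<bullet> frechet_derivative (flux \<gamma> a) (at u) k)) (at u)"
    using pair unfolding convex_entropy_pair_def by blast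
  define e where "e = (1::real, \<omega>, h)"
  have re: "ray \<omega> h \<rho> = \<rho> *\<^sub>R e" for \<rho> by (simp add: ray_def e_def)
  have R: "(ray \<omega> h has_derivative (\<lambda>x. x *\<^sub>R e)) (at \<rho>)" for \<rho>
    unfolding re[abs_def] by (auto intro!: derivative_eq_intros)
  define d where "d \<rho> = g (ray \<omega> h \<rho>) \<bullet> e" for \<rho>
  have "continuous_on {0<..} (\<lambda>\<rho>. g (ray \<omega> h \<rho>))"
    by (rule continuous_on_compose2[OF gc])
      (auto simp: ray_in_phase_space ray_def[abs_def] phase_space_alt intro!: continuous_intros)
  then have dc: "continuous_on {0<..} d" unfolding d_def by (intro continuous_intros)
  have E: "((\<lambda>\<rho>. \<eta> (ray \<omega> h \<rho>)) has_field_derivative d \<rho>) (at \<rho>)" if "0 < \<rho>" for \<rho>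
    using has_derivative_compose[OF R g(1)] that
    by (simp add: ray_in_phase_space has_field_derivative_def d_def mult_commute_abs)
  have Q: "((\<lambda>\<rho>. q (ray \<omega> h \<rho>)) has_field_derivative ray_speed \<gamma> a \<omega> h \<rho> * d \<rho>) (at \<rho>)"
    if \<rho>: "0 < \<rho>" for \<rho>
  proof -
    have u: "ray \<omega> h \<rho> \<in> phase_space" using \<rho> by (simp add: ray_in_phase_space)
    let ?D = "frechet_derivative (flux \<gamma> a) (at (ray \<omega> h \<rho>))"
    have "?D (1 *\<^sub>R ray \<omega> h \<rho>) = lambda1 \<gamma> a (ray \<omega> h \<rho>) *\<^sub>R 1 *\<^sub>R ray \<omega> h \<rho>"
      using scaleR_eigenvector_field[of 1] u by (simp add: eigenvector_field_def)
    then have D: "?D (\<rho> *\<^sub>R e) = ray_speed \<gamma> a \<omega> h \<rho> *\<^sub>R \<rho> *\<^sub>R e"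
      using lambda1_ray[OF \<rho>, of \<gamma> a \<omega> h] by (simp add: re)
    have lin: "linear ?D" by (rule linear_frechet_derivative[OF flux_differentiable[OF u]])
    have "?D (x *\<^sub>R e) = (ray_speed \<gamma> a \<omega> h \<rho> * x) *\<^sub>R e" for x
    proof -
      have "?D (x *\<^sub>R e) = ?D ((x / \<rho>) *\<^sub>R (\<rho> *\<^sub>R e))" using \<rho> by simp
      also have "\<dots> = (x / \<rho>) *\<^sub>R ?D (\<rho> *\<^sub>R e)" using lin by (rule linear_cmul)
      finally show ?thesis using \<rho> by (simp add: D mult.commute)
    qed
    then have "((\<lambda>\<rho>. q (ray \<omega> h \<rho>)) has_derivative
        (\<lambda>x. g (ray \<omega> h \<rho>) \<bullet> ((ray_speed \<gamma> a \<omega> h \<rho> * x) *\<^sub>R e))) (at \<rho>)"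
      using has_derivative_compose[OF R g(2)[OF u]] by simp
    then show ?thesis
      unfolding has_field_derivative_def
      by (rule has_derivative_eq_rhs) (simp add: d_def fun_eq_iff)
  qed
  have "convex_on {0<..} (\<lambda>\<rho>. \<eta> (ray \<omega> h \<rho>))"
  proof (rule convex_onI)
    fix t x y :: real assume t: "0 < t" "t < 1" and xy: "x \<in> {0<..}" "y \<in> {0<..}"
    have "ray \<omega> h ((1 - t) *\<^sub>R x + t *\<^sub>R y) = (1 - t) *\<^sub>R ray \<omega> h x + t *\<^sub>R ray \<omega> h y"
      by (simp add: re algebra_simps)
    then show "\<eta> (ray \<omega> h ((1 - t) *\<^sub>R x + t *\<^sub>R y)) \<le> (1 - t) * \<eta> (ray \<omega> h x) + t * \<eta> (ray \<omega> h y)"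
      using convex_onD[OF conv, of t "ray \<omega> h x" "ray \<omega> h y"] t xy
      by (simp add: ray_in_phase_space)
  qed simp
  from convex_on_imp_above_tangent[OF this]
  have tangent: "d x * (y - x) \<le> \<eta> (ray \<omega> h y) - \<eta> (ray \<omega> h x)" if "0 < x" "0 < y" for x y
    using E that by (simp add: interior_open has_field_derivative_at_within)
  have "d x \<le> d y" if "0 < x" "x \<le> y" for x y
  proof (cases "x = y")
    case False
    with that have "0 < y - x" "0 < y" by auto
    have "(d x - d y) * (y - x) \<le> 0"
      using tangent[of x y] tangent[of y x] that \<open>0 < y\<close> by (simp add: algebra_simps)
    with \<open>0 < y - x\<close> show ?thesis by (simp add: mult_le_0_iff)
  qed simp
  with that dc E Q show thesis by blast
qed

text \<open>By the mean value theorem, \<open>s = \<lambda>\<^sub>1(\<rho>\<^sub>0)\<close> for some \<open>\<rho>\<^sub>0\<close> between the two states. Subtracting the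
  linear entropy with slope \<open>d(\<rho>\<^sub>0)\<close>, which has no production, leaves an integrand
  \<open>(s - \<lambda>\<^sub>1)(d - d(\<rho>\<^sub>0))\<close> of two factors with the same sign.\<close>

lemma entropy_shock:
  assumes pair: "convex_entropy_pair phase_space (flux \<gamma> a) \<eta> q"
    and \<rho>: "0 < \<rho>l" "\<rho>l < \<rho>m"
    and s: "ray_flux \<gamma> a \<omega> h \<rho>m - ray_flux \<gamma> a \<omega> h \<rho>l = s * (\<rho>m - \<rho>l)"
  shows "q (ray \<omega> h \<rho>m) - q (ray \<omega> h \<rho>l) \<le> s * (\<eta> (ray \<omega> h \<rho>m) - \<eta> (ray \<omega> h \<rho>l))"
proof -
  let ?F = "ray_flux \<gamma> a \<omega> h" and ?l = "ray_speed \<gamma> a \<omega> h"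
  obtain d where "continuous_on {0<..} d"
    and mono: "\<And>\<rho> \<rho>'. 0 < \<rho> \<Longrightarrow> \<rho> \<le> \<rho>' \<Longrightarrow> d \<rho> \<le> d \<rho>'"
    and E: "\<And>\<rho>. 0 < \<rho> \<Longrightarrow> ((\<lambda>\<rho>. \<eta> (ray \<omega> h \<rho>)) has_field_derivative d \<rho>) (at \<rho>)"
    and Q: "\<And>\<rho>. 0 < \<rho> \<Longrightarrow> ((\<lambda>\<rho>. q (ray \<omega> h \<rho>)) has_field_derivative ?l \<rho> * d \<rho>) (at \<rho>)"
    by (rule entropy_ray[OF pair, of \<omega> h]) (rule that)
  have "\<exists>z>\<rho>l. z < \<rho>m \<and> ?F \<rho>m - ?F \<rho>l = (\<rho>m - \<rho>l) * ?l z"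
    using \<rho> by (intro MVT2 ray_flux_has_derivative) auto
  then obtain z where z: "\<rho>l < z" "z < \<rho>m" "?F \<rho>m - ?F \<rho>l = (\<rho>m - \<rho>l) * ?l z"
    by blast
  then have sz: "s = ?l z" using s \<rho>(2) by (simp add: mult.commute)
  define M where "M \<rho> = s * \<eta> (ray \<omega> h \<rho>) - q (ray \<omega> h \<rho>) - d z * (s * \<rho> - ?F \<rho>)" for \<rho>
  have "M \<rho>l \<le> M \<rho>m"
  proof (rule DERIV_nonneg_imp_nondecreasing[where f = M])
    fix x assume x: "\<rho>l \<le> x" "x \<le> \<rho>m"
    then have x0: "0 < x" using \<rho> by simp
    have "(M has_field_derivative s * d x - ?l x * d x - d z * (s * 1 - ?l x)) (at x)"
      unfolding M_def
      by (intro derivative_intros DERIV_cmult E[OF x0] Q[OF x0] ray_flux_has_derivative[OF x0])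
    moreover have "0 \<le> (s - ?l x) * (d x - d z)"
    proof (cases "x \<le> z")
      case True
      then show ?thesis
        using mono[OF x0 True] ray_speed_le_iff[of z x \<omega> h] x0 z(1) \<rho>(1)
        by (intro mult_nonpos_nonpos) (auto simp: sz)
    next
      case False
      then show ?thesis
        using mono[of z x] ray_speed_le_iff[of x z \<omega> h] x0 z(1) \<rho>(1)
        by (intro mult_nonneg_nonneg) (auto simp: sz)
    qed
    ultimately show "\<exists>y. (M has_real_derivative y) (at x) \<and> 0 \<le> y"
      by (auto simp: algebra_simps)
  qed (use \<rho> in simp)
  \<comment> \<open>The subtracted part is equal at both ends, by the jump condition, so comparing M
    at the ends compares the entropy alone.\<close>
  moreover have eq: "s * \<rho>m - ?F \<rho>m = s * \<rho>l - ?F \<rho>l" using s by (simp add: algebra_simps)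
  ultimately show ?thesis unfolding M_def eq by (simp add: right_diff_distrib)
qed

subsection \<open>The Riemann problem\<close>

lemma ray_speed_measurable: "ray_speed \<gamma> a \<omega> h \<in> borel_measurable borel"
  unfolding ray_speed_def[abs_def] pressure_def[abs_def] by (cases "\<gamma> = 0") simp_all

lemma riemann_data_measurable: "riemann_data ul ur \<in> borel_measurable lborel"
  unfolding riemann_data_def[abs_def] by simp

text \<open>Layer-cake representation: the fan takes the value at \<open>\<rho>s\<close> on the line \<open>p\<close>, so exactly the
  layers \<open>r > \<rho>s\<close> have been passed there.\<close>

lemma integral_fan:
  fixes F f :: "real \<Rightarrow> real"
  assumes f: "continuous_on {0<..} f" "\<And>r. 0 < r \<Longrightarrow> (F has_field_derivative f r) (at r)"
    and \<rho>: "0 < \<rho>m" "\<rho>m \<le> \<rho>s" "\<rho>s \<le> \<rho>l"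
    and \<sigma>: "\<sigma> \<in> borel_measurable borel"
    and layers: "\<And>r. r \<in> {\<rho>m..\<rho>l} \<Longrightarrow> r \<noteq> \<rho>s \<Longrightarrow> wedge (\<sigma> r) p = (if \<rho>s < r then 1 else 0)"
  shows "(LINT r|lborel. - (f r * indicator {\<rho>m..\<rho>l} r) * wedge (\<sigma> r) p) = F \<rho>s - F \<rho>l"
proof -
  have fm: "(\<lambda>r. f r * indicator {x..y} r) \<in> borel_measurable borel" if "0 < x" for x y
  proof -
    have "continuous_on {x..y} f" using f(1) by (rule continuous_on_subset) (use that in auto)
    then have "(\<lambda>r. indicator {x..y} r *\<^sub>R f r) \<in> borel_measurable borel"
      by (intro borel_measurable_continuous_on_indicator) auto
    then show ?thesis by (simp add: mult.commute)
  qed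
  have wm: "(\<lambda>r. wedge (\<sigma> r) p) \<in> borel_measurable borel"
    using \<sigma> unfolding wedge_def by measurable
  have "(LINT r|lborel. - (f r * indicator {\<rho>m..\<rho>l} r) * wedge (\<sigma> r) p)
      = (LINT r|lborel. - (f r * indicator {\<rho>s..\<rho>l} r))"
  proof (rule integral_cong_AE)
    show "AE r in lborel. - (f r * indicator {\<rho>m..\<rho>l} r) * wedge (\<sigma> r) p
        = - (f r * indicator {\<rho>s..\<rho>l} r)"
      \<comment> \<open>The layer at the actual density is a single point; whether it counts as
        passed does not affect the integral.\<close>
      using AE_lborel_singleton[of \<rho>s]
    proof eventually_elim
      case (elim r)
      then show ?case using layers[of r] \<rho> by (auto simp: indicator_def)
    qed
    show "(\<lambda>r. - (f r * indicator {\<rho>m..\<rho>l} r) * wedge (\<sigma> r) p) \<in> borel_measurable lborel"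
      using fm[OF \<rho>(1)] wm by simp
    show "(\<lambda>r. - (f r * indicator {\<rho>s..\<rho>l} r)) \<in> borel_measurable lborel"
      using fm[of \<rho>s] \<rho> by simp
  qed
  also have "\<dots> = F \<rho>s - F \<rho>l"
  proof -
    have "isCont f r" if "0 < r" for r
      using f(1) that by (simp add: continuous_on_eq_continuous_at)
    then have "(LINT r|lborel. f r * indicator {\<rho>s..\<rho>l} r) = F \<rho>l - F \<rho>s"
      using \<rho> f(2) by (intro integral_FTC_Icc_real) auto
    then show ?thesis by simp
  qed
  finally show ?thesis .
qed

section \<open>Solutions with a shock or a rarefaction fan\<close>

lemma shock_solution:
  assumes \<rho>: "0 < \<rho>l" "\<rho>l < \<rho>m"
    and s: "ray_flux \<gamma> a \<omega> h \<rho>m - ray_flux \<gamma> a \<omega> h \<rho>l = s * (\<rho>m - \<rho>l)"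
    and ur: "ur \<in> phase_space" "velocity \<gamma> a ur = velocity \<gamma> a (ray \<omega> h \<rho>m)"
    and sv: "s < velocity \<gamma> a ur"
  shows "entropy_weak_solution phase_space (flux \<gamma> a) (riemann_data (ray \<omega> h \<rho>l) ur)
     (\<lambda>t x. if x < t * s then ray \<omega> h \<rho>l
            else if x < t * velocity \<gamma> a ur then ray \<omega> h \<rho>m else ur)"
    (is "entropy_weak_solution _ _ _ ?u")
proof (rule entropy_weak_solutionI[where \<sigma> = s])
  let ?ul = "ray \<omega> h \<rho>l" and ?um = "ray \<omega> h \<rho>m" and ?vr = "velocity \<gamma> a ur"
  show "convex phase_space" by (rule convex_phase_space)
  show "flux \<gamma> a differentiable (at u)" if "u \<in> phase_space" for u
    using that by (rule flux_differentiable)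
  show "riemann_data ?ul ur \<in> borel_measurable lborel" by (rule riemann_data_measurable)
  have "(\<lambda>p. ?u (fst p) (snd p)) \<in> borel_measurable (borel \<Otimes>\<^sub>M borel)" by measurable
  then show "set_borel_measurable lborel {p. 0 < fst p} (\<lambda>p. ?u (fst p) (snd p))"
    unfolding set_borel_measurable_def borel_prod
    by (intro borel_measurable_scaleR borel_measurable_indicator)
      (auto intro!: borel_open open_Collect_less continuous_intros)
  show "compact {?ul, ?um, ur}" by (simp add: finite_imp_compact)
  show "{?ul, ?um, ur} \<subseteq> phase_space" using \<rho> ur by (simp add: ray_in_phase_space)
  show "riemann_data ?ul ur x \<in> {?ul, ?um, ur}" for x by (simp add: riemann_data_def)
  show "?u t x \<in> {?ul, ?um, ur}" for t x by simp
  fix \<eta> q assume pair: "convex_entropy_pair phase_space (flux \<gamma> a) \<eta> q"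
  let ?c = "s * (\<eta> ?um - \<eta> ?ul) - (q ?um - q ?ul)"
  have c: "0 \<le> ?c" using entropy_shock[OF pair \<rho> s] by simp
  have contact: "q ur - q ?um = ?vr * (\<eta> ur - \<eta> ?um)"
    using entropy_contact[OF pair _ ur] \<rho> ur(2) by (simp add: ray_in_phase_space)
  have "weak_form \<eta> q (riemann_data ?ul ur) ?u \<phi> \<phi>t \<phi>x = ?c * ray_integral \<phi> s"
    if test: "test_function \<phi> \<phi>t \<phi>x" for \<phi> \<phi>t \<phi>x
  proof -
    have "weak_form \<eta> q (riemann_data ?ul ur) ?u \<phi> \<phi>t \<phi>x =
       (s * (\<eta> ?um - \<eta> ?ul) - (q ?um - q ?ul)) * ray_integral \<phi> s
       + (?vr * (\<eta> ur - \<eta> ?um) - (q ur - q ?um)) * ray_integral \<phi> ?vr"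
    \<comment> \<open>No fan here: zero density of layers, and an arbitrary speed for them.\<close>
    proof (rule weak_form_self_similar[OF test, where k = "\<lambda>_. 0" and \<sigma> = "\<lambda>_. 0"
          and ?A0.0 = "\<eta> ?ul" and ?B0.0 = "q ?ul"])
      fix t x :: real assume t: "0 < t"
      \<comment> \<open>Points left of the shock are also left of the contact, so the nested
        conditionals are a sum of two wedges.\<close>
      have "x < t * s \<Longrightarrow> x < t * ?vr" using t sv by (meson less_trans mult_strict_left_mono)
      then show "\<eta> (?u t x) = \<eta> ?ul + (\<eta> ?um - \<eta> ?ul) * wedge s (t, x)
            + (\<eta> ur - \<eta> ?um) * wedge ?vr (t, x) + (LINT r::real|lborel. 0 * wedge 0 (t, x))"
        and "q (?u t x) = q ?ul + (q ?um - q ?ul) * wedge s (t, x)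
            + (q ur - q ?um) * wedge ?vr (t, x) + (LINT r::real|lborel. 0 * 0 * wedge 0 (t, x))"
        using t by (auto simp: wedge_def not_less)
    qed (auto simp: riemann_data_def)
    then show ?thesis by (simp add: contact)
  qed
  with c show "\<exists>c\<ge>0. \<forall>\<phi> \<phi>t \<phi>x. test_function \<phi> \<phi>t \<phi>x \<longrightarrow>
        weak_form \<eta> q (riemann_data ?ul ur) ?u \<phi> \<phi>t \<phi>x = c * ray_integral \<phi> s"
    by blast
qed

text \<open>The profile R enters only as a measurable right inverse of the speed, so the explicit
  formulas for all \<gamma> are treated alike. The interval of speeds is half open as in the
  conditionals of the solution.\<close>

lemma rarefaction_solution:
  fixes R :: "real \<Rightarrow> real"
  assumes \<rho>: "0 < \<rho>m" "\<rho>m < \<rho>l"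
    and ur: "ur \<in> phase_space" "velocity \<gamma> a ur = velocity \<gamma> a (ray \<omega> h \<rho>m)"
    and R: "R \<in> borel_measurable borel"
      "\<And>\<xi>. ray_speed \<gamma> a \<omega> h \<rho>l \<le> \<xi> \<Longrightarrow> \<xi> < ray_speed \<gamma> a \<omega> h \<rho>m \<Longrightarrow> 0 < R \<xi> \<and> ray_speed \<gamma> a \<omega> h (R \<xi>) = \<xi>"
  shows "entropy_weak_solution phase_space (flux \<gamma> a) (riemann_data (ray \<omega> h \<rho>l) ur)
     (\<lambda>t x. if x < t * ray_speed \<gamma> a \<omega> h \<rho>l then ray \<omega> h \<rho>l
            else if x < t * ray_speed \<gamma> a \<omega> h \<rho>m then ray \<omega> h (R (x / t))
            else if x < t * velocity \<gamma> a ur then ray \<omega> h \<rho>m else ur)"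
    (is "entropy_weak_solution _ _ _ ?u")
\<comment> \<open>No ray produces entropy here, so the choice of the ray is arbitrary.\<close>
proof (rule entropy_weak_solutionI[where \<sigma> = 0])
  let ?l = "ray_speed \<gamma> a \<omega> h"
  let ?ul = "ray \<omega> h \<rho>l" and ?um = "ray \<omega> h \<rho>m" and ?vr = "velocity \<gamma> a ur"
  let ?K = "insert ur (ray \<omega> h ` {\<rho>m..\<rho>l})"
  have pos: "0 < \<rho>l" using \<rho> by simp
  have um: "?um \<in> phase_space" using \<rho> by (simp add: ray_in_phase_space)
  have lv: "?l \<rho>m < ?vr"
    using lambda1_less_velocity[OF um] \<rho>(1) by (simp add: lambda1_ray ur(2))
  have fan: "\<rho>m \<le> R (x / t) \<and> R (x / t) \<le> \<rho>l \<and> t * ?l (R (x / t)) = x"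
    if "0 < t" "t * ?l \<rho>l \<le> x" "x < t * ?l \<rho>m" for t x
  proof -
    have "?l \<rho>l \<le> x / t" "x / t < ?l \<rho>m" using that by (auto simp: field_simps)
    note r = R(2)[OF this]
    have "\<rho>m \<le> R (x / t)" "R (x / t) \<le> \<rho>l"
      using ray_speed_le_iff[of "R (x / t)" \<rho>m \<omega> h] ray_speed_le_iff[of \<rho>l "R (x / t)" \<omega> h]
        r \<open>?l \<rho>l \<le> x / t\<close> \<open>x / t < ?l \<rho>m\<close> \<rho>(1) pos by auto
    then show ?thesis using r that(1) by simp
  qed
  show "convex phase_space" by (rule convex_phase_space)
  show "flux \<gamma> a differentiable (at u)" if "u \<in> phase_space" for u
    using that by (rule flux_differentiable)
  show "riemann_data ?ul ur \<in> borel_measurable lborel" by (rule riemann_data_measurable)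
  have "(\<lambda>p. ?u (fst p) (snd p)) \<in> borel_measurable (borel \<Otimes>\<^sub>M borel)"
    using R(1) unfolding ray_def by measurable
  then show "set_borel_measurable lborel {p. 0 < fst p} (\<lambda>p. ?u (fst p) (snd p))"
    unfolding set_borel_measurable_def borel_prod
    by (intro borel_measurable_scaleR borel_measurable_indicator)
      (auto intro!: borel_open open_Collect_less continuous_intros)
  show "compact ?K"
    by (intro compact_insert compact_continuous_image) (auto simp: ray_def intro!: continuous_intros)
  show "?K \<subseteq> phase_space" using \<rho> ur by (auto simp: ray_in_phase_space)
  show "riemann_data ?ul ur x \<in> ?K" for x using \<rho> by (auto simp: riemann_data_def)
  show "?u t x \<in> ?K" if "0 < t" for t x
    using fan[OF that, of x] \<rho> by (auto simp: not_less)
  fix \<eta> q assume pair: "convex_entropy_pair phase_space (flux \<gamma> a) \<eta> q"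
  have contact: "q ur - q ?um = ?vr * (\<eta> ur - \<eta> ?um)"
    using entropy_contact[OF pair um ur] ur(2) by simp
  obtain d where d: "continuous_on {0<..} d"
    and "\<And>\<rho> \<rho>'. 0 < \<rho> \<Longrightarrow> \<rho> \<le> \<rho>' \<Longrightarrow> d \<rho> \<le> d \<rho>'"
    and E: "\<And>\<rho>. 0 < \<rho> \<Longrightarrow> ((\<lambda>\<rho>. \<eta> (ray \<omega> h \<rho>)) has_field_derivative d \<rho>) (at \<rho>)"
    and Q: "\<And>\<rho>. 0 < \<rho> \<Longrightarrow> ((\<lambda>\<rho>. q (ray \<omega> h \<rho>)) has_field_derivative ?l \<rho> * d \<rho>) (at \<rho>)"
    by (rule entropy_ray[OF pair, of \<omega> h]) (rule that)
  have lc: "continuous_on {0<..} ?l"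
    unfolding ray_speed_def[abs_def]
    by (intro continuous_intros continuous_at_imp_continuous_on ballI
        DERIV_isCont[OF pressure_has_derivative]) auto
  have ld: "continuous_on {0<..} (\<lambda>r. ?l r * d r)" by (intro continuous_intros lc d)
  \<comment> \<open>The sign reflects that the density falls from \<rho>l to \<rho>m across the
    fan.\<close>
  define k where "k r = - (d r * indicator {\<rho>m..\<rho>l} r)" for r
  have int: "integrable lborel (\<lambda>r. - (f r * indicator {\<rho>m..\<rho>l} r))"
    if "continuous_on {0<..} f" for f :: "real \<Rightarrow> real"
  proof -
    have "continuous_on {\<rho>m..\<rho>l} f" using that by (rule continuous_on_subset) (use \<rho> in auto)
    then have "integrable lborel (\<lambda>r. indicator {\<rho>m..\<rho>l} r *\<^sub>R f r)"
      by (intro borel_integrable_compact) auto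
    then show ?thesis by (simp add: mult.commute)
  qed
  have lk: "?l r * k r = - ((?l r * d r) * indicator {\<rho>m..\<rho>l} r)" for r by (simp add: k_def)
  \<comment> \<open>With all speeds set to 0, every layer has been passed at the point (1, 0), so
    the layer-cake formula returns the total jump.\<close>
  have total: "(LINT r|lborel. k r) = \<eta> ?um - \<eta> ?ul"
    using integral_fan[OF d E \<rho>(1) order_refl, of \<rho>l "\<lambda>_. 0" "(1, 0)"] \<rho>
    by (auto simp: k_def wedge_def)
  have "weak_form \<eta> q (riemann_data ?ul ur) ?u \<phi> \<phi>t \<phi>x = 0 * ray_integral \<phi> 0"
    if test: "test_function \<phi> \<phi>t \<phi>x" for \<phi> \<phi>t \<phi>x
  proof -
    have "weak_form \<eta> q (riemann_data ?ul ur) ?u \<phi> \<phi>t \<phi>x = (0 * 0 - 0) * ray_integral \<phi> 0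
       + (?vr * (\<eta> ur - \<eta> ?um) - (q ur - q ?um)) * ray_integral \<phi> ?vr"
    proof (rule weak_form_self_similar[OF test, where k = k and \<sigma> = ?l
          and ?A0.0 = "\<eta> ?ul" and ?B0.0 = "q ?ul"])
      show "integrable lborel k" unfolding k_def by (rule int[OF d])
      show "integrable lborel (\<lambda>r. ?l r * k r)" unfolding lk by (rule int[OF ld])
      show "?l \<in> borel_measurable borel" by (rule ray_speed_measurable)
      show "\<eta> (riemann_data ?ul ur x) =
          \<eta> ?ul + (0 + (\<eta> ur - \<eta> ?um) + (LINT r|lborel. k r)) * indicator {0..} x" for x
        by (simp add: total riemann_data_def)
    next
      fix t x :: real assume t: "0 < t"
      \<comment> \<open>The density due to the first wave alone; right of the fan it stays at
        \<rho>m, even beyond the contact.\<close>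
      define \<rho>s where "\<rho>s = (if x < t * ?l \<rho>l then \<rho>l else if x < t * ?l \<rho>m then R (x / t) else \<rho>m)"
      have \<rho>s: "\<rho>m \<le> \<rho>s" "\<rho>s \<le> \<rho>l" using fan[OF t, of x] \<rho> by (auto simp: \<rho>s_def)
      have layers: "wedge (?l r) (t, x) = (if \<rho>s < r then 1 else 0)"
        if r: "r \<in> {\<rho>m..\<rho>l}" "r \<noteq> \<rho>s" for r
      proof -
        have r0: "0 < r" using r \<rho> by auto
        have "t * ?l r \<le> x \<longleftrightarrow> \<rho>s < r"
        proof (cases "x < t * ?l \<rho>l")
          case True
          have "?l \<rho>l \<le> ?l r" using ray_speed_le_iff[OF pos r0] r(1) by simp
          then have "t * ?l \<rho>l \<le> t * ?l r" using t by simp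
          with True r show ?thesis by (simp add: \<rho>s_def)
        next
          case left: False
          show ?thesis
          proof (cases "x < t * ?l \<rho>m")
            case True
            then have \<rho>s: "\<rho>s = R (x / t)" using left by (simp add: \<rho>s_def)
            have f: "0 < \<rho>s" "x = t * ?l \<rho>s" using fan[OF t, of x] left True \<rho>(1) by (auto simp: \<rho>s)
            have "t * ?l r \<le> x \<longleftrightarrow> ?l r \<le> ?l \<rho>s" using t by (simp add: f(2))
            also have "\<dots> \<longleftrightarrow> \<rho>s \<le> r" by (rule ray_speed_le_iff[OF r0 f(1)])
            finally show ?thesis using r(2) by auto
          next
            case False
            have "?l r \<le> ?l \<rho>m" using ray_speed_le_iff[OF r0 \<rho>(1)] r(1) by simp
            then have "t * ?l r \<le> t * ?l \<rho>m" using t by simp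
            with False left r show ?thesis by (simp add: \<rho>s_def)
          qed
        qed
        then show ?thesis using t by (simp add: wedge_def)
      qed
      have A: "(LINT r|lborel. k r * wedge (?l r) (t, x)) = \<eta> (ray \<omega> h \<rho>s) - \<eta> ?ul"
        unfolding k_def by (rule integral_fan[OF d E \<rho>(1) \<rho>s ray_speed_measurable layers])
      have B: "(LINT r|lborel. ?l r * k r * wedge (?l r) (t, x)) = q (ray \<omega> h \<rho>s) - q ?ul"
        unfolding lk by (rule integral_fan[OF ld Q \<rho>(1) \<rho>s ray_speed_measurable layers])
      have "?l \<rho>l \<le> ?l \<rho>m" using ray_speed_le_iff[OF pos \<rho>(1)] \<rho> by simp
      then have o: "t * ?l \<rho>l \<le> t * ?l \<rho>m" "t * ?l \<rho>m < t * ?vr" using t lv by auto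
      have u: "?u t x = (if t * ?vr \<le> x then ur else ray \<omega> h \<rho>s)"
        "t * ?vr \<le> x \<Longrightarrow> \<rho>s = \<rho>m"
        using o by (auto simp: \<rho>s_def)
      show "\<eta> (?u t x) = \<eta> ?ul + 0 * wedge 0 (t, x) + (\<eta> ur - \<eta> ?um) * wedge ?vr (t, x)
          + (LINT r|lborel. k r * wedge (?l r) (t, x))"
        unfolding A u(1) using t u(2) by (simp add: wedge_def)
      show "q (?u t x) = q ?ul + 0 * wedge 0 (t, x) + (q ur - q ?um) * wedge ?vr (t, x)
          + (LINT r|lborel. ?l r * k r * wedge (?l r) (t, x))"
        unfolding B u(1) using t u(2) by (simp add: wedge_def)
    qed
    then show ?thesis by (simp add: contact)
  qed
  then show "\<exists>c\<ge>0. \<forall>\<phi> \<phi>t \<phi>x. test_function \<phi> \<phi>t \<phi>x \<longrightarrow>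
        weak_form \<eta> q (riemann_data ?ul ur) ?u \<phi> \<phi>t \<phi>x = c * ray_integral \<phi> 0"
    by blast
qed

end

section \<open>Explicit densities of the intermediate state and of the fan\<close>

text \<open>The intermediate density comes from solving v + a P(\<rho>) = \<omega> for v = vr on the
  ray of the left state. For \<gamma> > 0 the pressure takes only positive values on positive
  densities, whence the positivity hypothesis; the logarithm takes all values. Factoring out \<rho>l
  exhibits \<alpha> as the density ratio across the first wave.\<close>

lemma rho_bar:
  assumes "0 \<le> \<gamma>" "0 < a hl" "0 < \<rho>l"
    and "0 < \<gamma> \<longrightarrow> 0 < \<rho>l powr \<gamma> + \<gamma> * (vl - vr) / a hl"
  shows rho_bar_pos: "0 < rho_bar \<gamma> a \<rho>l vl hl vr"
    and pressure_rho_bar: "vr + a hl * pressure \<gamma> (rho_bar \<gamma> a \<rho>l vl hl vr) = vl + a hl * pressure \<gamma> \<rho>l"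
    and rho_bar_shock_alpha: "rho_bar \<gamma> a \<rho>l vl hl vr = shock_alpha \<gamma> a \<rho>l vl hl vr * \<rho>l"
proof -
  have "0 < rho_bar \<gamma> a \<rho>l vl hl vr \<and>
    vr + a hl * pressure \<gamma> (rho_bar \<gamma> a \<rho>l vl hl vr) = vl + a hl * pressure \<gamma> \<rho>l \<and>
    rho_bar \<gamma> a \<rho>l vl hl vr = shock_alpha \<gamma> a \<rho>l vl hl vr * \<rho>l"
  proof (cases "\<gamma> = 0")
    case True
    with assms show ?thesis
      by (simp add: rho_bar_def shock_alpha_def pressure_def ln_mult field_simps)
  next
    case False
    with assms have g: "0 < \<gamma>" and X: "0 < \<rho>l powr \<gamma> + \<gamma> * (vl - vr) / a hl" (is "0 < ?X") by auto
    have "(?X powr (1 / \<gamma>)) powr \<gamma> = ?X" using g X by (simp add: powr_powr)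
    moreover have "1 + \<gamma> * (vl - vr) / (a hl * \<rho>l powr \<gamma>) = ?X / \<rho>l powr \<gamma>"
      using assms(2,3) by (simp add: field_simps)
    then have "(1 + \<gamma> * (vl - vr) / (a hl * \<rho>l powr \<gamma>)) powr (1 / \<gamma>) = ?X powr (1 / \<gamma>) / \<rho>l"
      using X g assms(3) by (simp add: powr_divide powr_powr)
    ultimately show ?thesis
      using g X assms(2,3)
      by (simp add: rho_bar_def shock_alpha_def pressure_def) (simp add: field_simps)
  qed
  then show "0 < rho_bar \<gamma> a \<rho>l vl hl vr"
    "vr + a hl * pressure \<gamma> (rho_bar \<gamma> a \<rho>l vl hl vr) = vl + a hl * pressure \<gamma> \<rho>l"
    "rho_bar \<gamma> a \<rho>l vl hl vr = shock_alpha \<gamma> a \<rho>l vl hl vr * \<rho>l" by auto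
qed

text \<open>The fan density solves \<lambda>1 = x/t on the ray: \<omega> - a (ln \<rho> + 1) = x/t
  explains the -1 in the exponent, and P + \<rho> P' = (1 + \<gamma>)/\<gamma> times the power
  explains the constant for \<gamma> > 0.\<close>

lemma ray_speed_rho_rf:
  assumes "0 \<le> \<gamma>" "0 < a h" "0 < \<gamma> \<Longrightarrow> x / t < \<omega>"
  shows "0 < rho_rf \<gamma> a \<omega> h t x \<and> ray_speed \<gamma> a \<omega> h (rho_rf \<gamma> a \<omega> h t x) = x / t"
proof (cases "\<gamma> = 0")
  case True
  have "a h * ((\<omega> - x / t) / a h) = \<omega> - x / t" using assms(2) by simp
  with True assms show ?thesis
    by (simp add: rho_rf_def ray_speed_def pressure_def del: times_divide_eq_right)
next
  case False
  with assms have g: "0 < \<gamma>" and lt: "0 < \<omega> - x / t" by auto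
  define X where "X = \<gamma> * (\<omega> - x / t) / ((1 + \<gamma>) * a h)"
  have X: "0 < X" unfolding X_def using g lt assms(2) by (intro divide_pos_pos mult_pos_pos) auto
  have XX: "(X powr (1 / \<gamma>)) powr \<gamma> = X" using g X by (simp add: powr_powr)
  have "1 + \<gamma> \<noteq> 0" using g by simp
  then have "a h * (\<gamma> * y / ((1 + \<gamma>) * a h) / \<gamma> + \<gamma> * y / ((1 + \<gamma>) * a h)) = y" for y
    using g assms(2) by (simp add: divide_simps) (simp add: algebra_simps)
  from this[of "\<omega> - x / t"] have "a h * (X / \<gamma> + X) = \<omega> - x / t" unfolding X_def .
  moreover have "rho_rf \<gamma> a \<omega> h t x = X powr (1 / \<gamma>)" using False by (simp add: rho_rf_def X_def)
  ultimately show ?thesis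
    using False X by (simp add: ray_speed_def pressure_def XX)
qed

text \<open>Both end states of the first wave lie on one ray, where velocity and \<lambda>1 decrease
  with density. So the sign of \<open>vr - vl\<close> decides whether the speeds spread or compress.
  The hypothesis \<open>no_vacuum\<close> makes the intermediate density positive for \<gamma> >
  0.\<close>

theorem theorem3p2:
  fixes \<gamma> \<rho>l vl hl \<rho>r vr hr :: real
    and a :: "real \<Rightarrow> real"
    and ul ur um :: state
    and \<omega>l s \<alpha> :: real
  assumes gamma: "0 \<le> \<gamma>"
    and a_pos: "\<And>h. 0 < a h"
    and a_C1: "a C1_differentiable_on UNIV"
    and rho_pos: "0 < \<rho>l" "0 < \<rho>r"
    and no_vacuum: "0 < \<gamma> \<Longrightarrow> 0 < \<rho>l powr \<gamma> + \<gamma> * (vl - vr) / a hl"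
    and ul: "ul = state_of \<gamma> a \<rho>l vl hl"
    and ur: "ur = state_of \<gamma> a \<rho>r vr hr"
    and um: "um = state_of \<gamma> a (rho_bar \<gamma> a \<rho>l vl hl vr) vr hl"
    and omega: "\<omega>l = vl + a hl * pressure \<gamma> \<rho>l"
    and alpha: "\<alpha> = shock_alpha \<gamma> a \<rho>l vl hl vr"
    and s: "s = (vl - \<alpha> * vr) / (1 - \<alpha>)"
  shows
    "(vl < vr \<longrightarrow>
        lambda1 \<gamma> a ul < lambda1 \<gamma> a um \<and> lambda1 \<gamma> a um < vr \<and>
        (\<forall>t x. 0 < t \<and> t * lambda1 \<gamma> a ul < x \<and> x < t * lambda1 \<gamma> a um \<longrightarrow>
           lambda1 \<gamma> a (u_rf \<gamma> a \<omega>l hl t x) = x / t \<and>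
           u_rf \<gamma> a \<omega>l hl t x \<in> rarefaction_curve phase_space (flux \<gamma> a) (lambda1 \<gamma> a) ul) \<and>
        entropy_weak_solution phase_space (flux \<gamma> a) (riemann_data ul ur)
          (\<lambda>t x. if x < t * lambda1 \<gamma> a ul then ul
                 else if x < t * lambda1 \<gamma> a um then u_rf \<gamma> a \<omega>l hl t x
                 else if x < t * vr then um
                 else ur))
     \<and> (vr < vl \<longrightarrow>
        lax_shock (flux \<gamma> a) (lambda1 \<gamma> a) ul um s \<and> s < vr \<and>
        entropy_weak_solution phase_space (flux \<gamma> a) (riemann_data ul ur)
          (\<lambda>t x. if x < t * s then ul
                 else if x < t * vr then um
                 else ur))
     \<and> temple_class phase_space (flux \<gamma> a) {lambda1 \<gamma> a, lambda2 \<gamma> a}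
     \<and> {u \<in> hugoniot_locus phase_space (flux \<gamma> a) (lambda1 \<gamma> a) ul.
           velocity \<gamma> a u = vr} = {um}
     \<and> {u \<in> rarefaction_curve phase_space (flux \<gamma> a) (lambda1 \<gamma> a) ul.
           velocity \<gamma> a u = vr} = {um}
     \<and> contact_discontinuity (flux \<gamma> a) (lambda2 \<gamma> a) um ur vr"
proof -
  interpret traffic_model \<gamma> a by unfold_locales (use gamma a_pos a_C1 in auto)
  let ?\<rho> = "rho_bar \<gamma> a \<rho>l vl hl vr" and ?l = "ray_speed \<gamma> a \<omega>l hl"
  have "0 < \<gamma> \<longrightarrow> 0 < \<rho>l powr \<gamma> + \<gamma> * (vl - vr) / a hl" using no_vacuum by blast
  note bar = rho_bar[of \<gamma> a hl \<rho>l vl vr, OF gamma a_pos rho_pos(1) this]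
  have ul_ray: "ul = ray \<omega>l hl \<rho>l" by (simp add: ul omega state_of_eq_ray)
  have um_ray: "um = ray \<omega>l hl ?\<rho>" by (simp add: um omega state_of_eq_ray bar(2))
  have ul_in: "ul \<in> phase_space" and um_in: "um \<in> phase_space" and ur_in: "ur \<in> phase_space"
    using rho_pos bar(1) by (auto simp: ul_ray um_ray ur state_of_eq_ray ray_in_phase_space)
  have v: "velocity \<gamma> a ul = vl" "velocity \<gamma> a um = vr" "velocity \<gamma> a ur = vr"
    using rho_pos bar(1) by (simp_all add: ul um ur velocity_state_of)
  have l: "lambda1 \<gamma> a ul = ?l \<rho>l" "lambda1 \<gamma> a um = ?l ?\<rho>"
    using rho_pos bar(1) by (simp_all add: ul_ray um_ray lambda1_ray)
  have order: "?\<rho> < \<rho>l \<longleftrightarrow> vl < vr" "\<rho>l < ?\<rho> \<longleftrightarrow> vr < vl"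
  proof -
    have "a hl * (pressure \<gamma> \<rho>l - pressure \<gamma> ?\<rho>) = vr - vl"
      using bar(2) by (simp add: algebra_simps)
    then have "vl < vr \<longleftrightarrow> 0 < a hl * (pressure \<gamma> \<rho>l - pressure \<gamma> ?\<rho>)"
      "vr < vl \<longleftrightarrow> a hl * (pressure \<gamma> \<rho>l - pressure \<gamma> ?\<rho>) < 0" by auto
    then show "?\<rho> < \<rho>l \<longleftrightarrow> vl < vr" "\<rho>l < ?\<rho> \<longleftrightarrow> vr < vl"
      using pressure_less_iff[OF gamma bar(1) rho_pos(1)] pressure_less_iff[OF gamma rho_pos(1) bar(1)]
        a_pos[of hl] by (auto simp: zero_less_mult_iff mult_less_0_iff)
  qed
  have um_lv: "?l ?\<rho> < vr" using lambda1_less_velocity[OF um_in] by (simp add: l v)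
  have rf: "0 < rho_rf \<gamma> a \<omega>l hl t x \<and> ?l (rho_rf \<gamma> a \<omega>l hl t x) = x / t"
    if "x / t < ?l ?\<rho>" for t x
  proof (rule ray_speed_rho_rf[of \<gamma> a hl x t \<omega>l, OF gamma a_pos])
    \<comment> \<open>For \<gamma> > 0 the pressure is nonnegative, so \<lambda>1 never exceeds
      \<omega> on the ray; this keeps the base of the power in \<open>rho_rf\<close>
      positive.\<close>
    assume g: "0 < \<gamma>"
    have "0 \<le> pressure \<gamma> ?\<rho> + ?\<rho> powr \<gamma>" using g by (simp add: pressure_def)
    then have "?l ?\<rho> \<le> \<omega>l" using a_pos[of hl] by (simp add: ray_speed_def)
    with that show "x / t < \<omega>l" by simp
  qed
  have u_rf: "u_rf \<gamma> a \<omega>l hl t x = ray \<omega>l hl (rho_rf \<gamma> a \<omega>l hl t x)" for t x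
    by (simp add: u_rf_def ray_def Let_def)
  have locus: "{k *\<^sub>R ul |k. 0 < k} = ray \<omega>l hl ` {0<..}"
  proof (intro equalityI subsetI)
    fix u assume "u \<in> ray \<omega>l hl ` {0<..}"
    then obtain r where r: "0 < r" "u = ray \<omega>l hl r" by auto
    have "u = (r / \<rho>l) *\<^sub>R ul" "0 < r / \<rho>l" using r rho_pos by (simp_all add: ul_ray ray_def)
    then show "u \<in> {k *\<^sub>R ul |k. 0 < k}" by blast
  qed (use rho_pos in \<open>auto simp: ul_ray ray_def intro!: image_eqI[where x = "_ * \<rho>l"]\<close>)
  \<comment> \<open>Velocity is injective along a ray. Hugoniot locus and rarefaction curve are the
    same ray, so this one computation gives both statements about the intermediate state.\<close>
  have meet: "{u \<in> {k *\<^sub>R ul |k. 0 < k}. velocity \<gamma> a u = vr} = {um}"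
  proof -
    have uniq: "r = ?\<rho>" if "0 < r" "velocity \<gamma> a (ray \<omega>l hl r) = vr" for r
    proof (rule pressure_inj[OF gamma that(1) bar(1)])
      have "\<omega>l - a hl * pressure \<gamma> r = vr" using that by (simp add: velocity_ray)
      moreover have "\<omega>l - a hl * pressure \<gamma> ?\<rho> = vr"
        using v(2) by (simp add: um_ray velocity_ray[OF bar(1)])
      ultimately have "a hl * pressure \<gamma> r = a hl * pressure \<gamma> ?\<rho>"
        by (metis add_diff_cancel_left' diff_add_cancel)
      then show "pressure \<gamma> r = pressure \<gamma> ?\<rho>" using a_pos[of hl] by simp
    qed
    show ?thesis unfolding locus
    proof (intro equalityI subsetI)
      fix u assume "u \<in> {u \<in> ray \<omega>l hl ` {0<..}. velocity \<gamma> a u = vr}"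
      then obtain r where r: "0 < r" "u = ray \<omega>l hl r" "velocity \<gamma> a u = vr" by blast
      have "r = ?\<rho>" using r(3) unfolding r(2) by (rule uniq[OF r(1)])
      then show "u \<in> {um}" by (simp add: um_ray r(2))
    next
      have "um \<in> ray \<omega>l hl ` {0<..}" unfolding um_ray using bar(1) by simp
      then show "u \<in> {u \<in> ray \<omega>l hl ` {0<..}. velocity \<gamma> a u = vr}" if "u \<in> {um}" for u
        using that v(2) by blast
    qed
  qed
  have rarefaction: "lambda1 \<gamma> a ul < lambda1 \<gamma> a um \<and> lambda1 \<gamma> a um < vr \<and>
        (\<forall>t x. 0 < t \<and> t * lambda1 \<gamma> a ul < x \<and> x < t * lambda1 \<gamma> a um \<longrightarrow>
           lambda1 \<gamma> a (u_rf \<gamma> a \<omega>l hl t x) = x / t \<and>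
           u_rf \<gamma> a \<omega>l hl t x \<in> rarefaction_curve phase_space (flux \<gamma> a) (lambda1 \<gamma> a) ul) \<and>
        entropy_weak_solution phase_space (flux \<gamma> a) (riemann_data ul ur)
          (\<lambda>t x. if x < t * lambda1 \<gamma> a ul then ul
                 else if x < t * lambda1 \<gamma> a um then u_rf \<gamma> a \<omega>l hl t x
                 else if x < t * vr then um
                 else ur)" if "vl < vr"
  proof (intro conjI allI impI; (elim conjE)?)
    have lt: "?\<rho> < \<rho>l" using order that by simp
    show "lambda1 \<gamma> a ul < lambda1 \<gamma> a um" "lambda1 \<gamma> a um < vr"
      using ray_speed_strict_antimono[OF bar(1) lt] um_lv by (simp_all add: l)
    fix t x :: real assume t: "0 < t" and x: "x < t * lambda1 \<gamma> a um"
    have "x / t < ?l ?\<rho>" using t x by (simp add: l field_simps)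
    note r = rf[OF this]
    then show "lambda1 \<gamma> a (u_rf \<gamma> a \<omega>l hl t x) = x / t" by (simp add: u_rf lambda1_ray)
    show "u_rf \<gamma> a \<omega>l hl t x \<in> rarefaction_curve phase_space (flux \<gamma> a) (lambda1 \<gamma> a) ul"
      using r unfolding rarefaction_curve_lambda1[OF ul_in] locus u_rf by simp
  next
    have lt: "?\<rho> < \<rho>l" using order that by simp
    have m: "rho_rf \<gamma> a \<omega>l hl 1 \<in> borel_measurable borel"
      unfolding rho_rf_def[abs_def] by (cases "\<gamma> = 0") simp_all
    \<comment> \<open>The profile depends on x/t alone, so its section at t = 1 serves as the
      function R.\<close>
    have u_rf1: "u_rf \<gamma> a \<omega>l hl t x = ray \<omega>l hl (rho_rf \<gamma> a \<omega>l hl 1 (x / t))" for t x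
      by (simp add: u_rf rho_rf_def)
    have vr: "velocity \<gamma> a ur = velocity \<gamma> a (ray \<omega>l hl ?\<rho>)" unfolding um_ray[symmetric] v ..
    show "entropy_weak_solution phase_space (flux \<gamma> a) (riemann_data ul ur)
          (\<lambda>t x. if x < t * lambda1 \<gamma> a ul then ul
                 else if x < t * lambda1 \<gamma> a um then u_rf \<gamma> a \<omega>l hl t x
                 else if x < t * vr then um
                 else ur)"
      unfolding u_rf1 l
      by (rule rarefaction_solution[OF bar(1) lt ur_in vr m, folded ul_ray um_ray, unfolded v(3)])
        (rule rf[where t = 1, simplified])
  qed
  have shock: "lax_shock (flux \<gamma> a) (lambda1 \<gamma> a) ul um s \<and> s < vr \<and>
        entropy_weak_solution phase_space (flux \<gamma> a) (riemann_data ul ur)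
          (\<lambda>t x. if x < t * s then ul
                 else if x < t * vr then um
                 else ur)" if "vr < vl"
  proof -
    have lt: "\<rho>l < ?\<rho>" using order that by simp
    have F: "ray_flux \<gamma> a \<omega>l hl \<rho>l = \<rho>l * vl" "ray_flux \<gamma> a \<omega>l hl ?\<rho> = ?\<rho> * vr"
      using v(1,2)
      by (simp_all add: ul_ray um_ray ray_flux_def velocity_ray[OF rho_pos(1)] velocity_ray[OF bar(1)])
    have \<alpha>: "\<alpha> = ?\<rho> / \<rho>l" using bar(3) rho_pos by (simp add: alpha)
    \<comment> \<open>On the ray the flux is density times velocity. With \<alpha> the density
      ratio, the stated speed is therefore the secant slope of \<open>ray_flux\<close>.\<close>
    have s_eq: "s = (?\<rho> * vr - \<rho>l * vl) / (?\<rho> - \<rho>l)"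
    proof -
      have "vl - \<alpha> * vr = (\<rho>l * vl - ?\<rho> * vr) / \<rho>l" "1 - \<alpha> = (\<rho>l - ?\<rho>) / \<rho>l"
        using rho_pos by (simp_all add: \<alpha> field_simps)
      then have "s = (\<rho>l * vl - ?\<rho> * vr) / (\<rho>l - ?\<rho>)" using rho_pos by (simp add: s)
      also have "\<dots> = (?\<rho> * vr - \<rho>l * vl) / (?\<rho> - \<rho>l)"
        by (metis minus_diff_eq minus_divide_divide)
      finally show ?thesis .
    qed
    then have sec: "ray_flux \<gamma> a \<omega>l hl ?\<rho> - ray_flux \<gamma> a \<omega>l hl \<rho>l = s * (?\<rho> - \<rho>l)"
      using lt by (simp add: F)
    \<comment> \<open>The secant slope is \<lambda>1 at an intermediate density, so strict
      monotonicity of the speed yields both Lax inequalities.\<close>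
    have "\<exists>z>\<rho>l. z < ?\<rho> \<and> ray_flux \<gamma> a \<omega>l hl ?\<rho> - ray_flux \<gamma> a \<omega>l hl \<rho>l = (?\<rho> - \<rho>l) * ?l z"
      using lt rho_pos by (intro MVT2 ray_flux_has_derivative) auto
    then obtain z where z: "\<rho>l < z" "z < ?\<rho>" "s = ?l z" using sec lt by (auto simp: mult.commute)
    have "?l ?\<rho> < s" "s < ?l \<rho>l"
      using ray_speed_strict_antimono[of z ?\<rho>] ray_speed_strict_antimono[of \<rho>l z] z rho_pos by auto
    moreover have "rankine_hugoniot (flux \<gamma> a) ul um s"
      unfolding ul_ray um_ray rankine_hugoniot_ray[OF rho_pos(1) bar(1)]
      using sec by (simp add: algebra_simps)
    ultimately have lax: "lax_shock (flux \<gamma> a) (lambda1 \<gamma> a) ul um s" by (simp add: lax_shock_def l)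
    have "?\<rho> * vr - \<rho>l * vl < vr * (?\<rho> - \<rho>l)"
      using that rho_pos by (simp add: algebra_simps)
    then have sv: "s < vr" using lt by (simp add: s_eq divide_less_eq)
    have vr: "velocity \<gamma> a ur = velocity \<gamma> a (ray \<omega>l hl ?\<rho>)" unfolding um_ray[symmetric] v ..
    show ?thesis
      using lax sv shock_solution[OF rho_pos(1) lt sec ur_in vr, folded ul_ray um_ray, unfolded v(3)]
      by blast
  qed
  have "contact_discontinuity (flux \<gamma> a) (lambda2 \<gamma> a) um ur vr"
    by (simp add: contact_discontinuity_def rankine_hugoniot_def lambda2_def flux_def v scaleR_diff_right)
  then show ?thesis
    using rarefaction shock temple_class meet
    unfolding hugoniot_locus_lambda1[OF ul_in] rarefaction_curve_lambda1[OF ul_in] by blast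
qed

end
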